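(* Let $m$, $n$ be positive integers with $n>1$ square-free, let $x=m^2n$, and let $\lambda=\phi(2n)/2$. Then the Aurifeuillian factors $F_n^{\pm}(x)=C_n(x)\pm mn\,D_n(x)$ of $F_n(x)$ are given by $$F_n^{-}(x)=\left\lfloor \hat F+\tfrac12\right\rfloor\qquad\text{and}\qquad F_n^{+}(x)=F_n(x)/F_n^{-}(x),$$ where $$\hat F=\sqrt{F_n(x)}\,\exp\left(-\frac1m\sum_{j=0}^{\lambda-1}\frac{(n\,|\,2j+1)}{(2j+1)\,x^j}\right).$$
   Context: $\Phi_k$ denotes the $k$-th cyclotomic polynomial and $\phi$ Euler's totient function. For square-free $n>1$ let $s=-1$ if $n\equiv 3\pmod 4$ and $s=+1$ otherwise, and define $$F_n(x)=\begin{cases}\Phi_n(sx), & n\text{ odd},\\ (-1)^{\phi(n/2)}\,\Phi_{n/2}(-x^2), & n\text{ even}.\end{cases}$$ $C_n(x)$ and $D_n(x)$ are the monic polynomials with integer coefficients satisfying $F_n(x)=C_n(x)^2-n\,x\,D_n(x)^2$. In general $F_n^{\pm}(x)=C_n(x)\pm\sqrt{nx}\,D_n(x)$; for $x=m^2n$ one has $\sqrt{nx}=mn$. $(a\,|\,b)$, for odd $b>0$, is the Jacobi symbol, with $(a\,|\,b)=0$ if $\gcd(a,b)>1$ and $(a\,|\,1)=1$. $\sqrt{F_n(x)}$ is the positive square root. *)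

theory Defs
  imports
    "HOL-Number_Theory.Number_Theory"
    "HOL-Computational_Algebra.Computational_Algebra"
begin

definition primitive_roots_unity :: "nat \<Rightarrow> complex set" where
  "primitive_roots_unity k = {z. z ^ k = 1 \<and> (\<forall>j\<in>{0<..<k}. z ^ j \<noteq> 1)}"

(* The polynomial over the complex numbers has integer coefficients; cyclotomic_spec below
   shows that the description is proper for every k > 0. *)
definition cyclotomic :: "nat \<Rightarrow> int poly" where
  "cyclotomic k = (THE p. map_poly of_int p = (\<Prod>z\<in>primitive_roots_unity k. [:- z, 1:]))"

definition jacobi :: "int \<Rightarrow> nat \<Rightarrow> int" where
  "jacobi a b = (\<Prod>p\<in>#prime_factorization b. Legendre a (int p))"

definition aurif_sign :: "nat \<Rightarrow> int" where
  "aurif_sign n = (if n mod 4 = 3 then - 1 else 1)"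

definition aurif_F :: "nat \<Rightarrow> int poly" where
  "aurif_F n =
     (if odd n then pcompose (cyclotomic n) [:0, aurif_sign n:]
      else smult ((- 1) ^ totient (n div 2)) (pcompose (cyclotomic (n div 2)) [:0, 0, - 1:]))"

(* C and D play the role of C_n and D_n. They are introduced by their defining property;
   monicity of D fixes the sign of D. *)
definition is_aurif_pair :: "nat \<Rightarrow> int poly \<Rightarrow> int poly \<Rightarrow> bool" where
  "is_aurif_pair n C D \<longleftrightarrow>
     lead_coeff C = 1 \<and> lead_coeff D = 1 \<and> aurif_F n = C\<^sup>2 - [:0, int n:] * D\<^sup>2"

lemma map_poly_of_int_mult:
  "map_poly of_int (p * q) = (map_poly of_int p * map_poly of_int q :: complex poly)"
  by (rule poly_eqI) (simp add: coeff_map_poly coeff_mult)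

lemma map_poly_of_int_prod:
  "map_poly of_int (\<Prod>x\<in>A. f x) = (\<Prod>x\<in>A. map_poly of_int (f x) :: complex poly)"
  by (induction A rule: infinite_finite_induct) (simp_all add: map_poly_of_int_mult)

lemma finite_primitive_roots_unity: "k > 0 \<Longrightarrow> finite (primitive_roots_unity k)"
  by (rule finite_subset[OF _ finite_roots_unity[of k]]) (auto simp: primitive_roots_unity_def)

lemma roots_unity_conv_primitive:
  assumes "k > 0"
  shows "{z. z ^ k = 1} = (\<Union>d\<in>{d. d dvd k}. primitive_roots_unity d)"
proof (intro equalityI subsetI)
  fix z :: complex assume z: "z \<in> {z. z ^ k = 1}"
  define d where "d = (LEAST j. j > 0 \<and> z ^ j = 1)"
  have d: "d > 0 \<and> z ^ d = 1"
    unfolding d_def by (rule LeastI[of _ k]) (use assms z in auto)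
  have least: "z ^ j \<noteq> 1" if "0 < j" "j < d" for j
    using not_less_Least[of j "\<lambda>j. j > 0 \<and> z ^ j = 1"] that by (auto simp: d_def)
  have "z ^ k = z ^ (d * (k div d)) * z ^ (k mod d)"
    by (simp flip: power_add)
  then have "z ^ (k mod d) = 1"
    using z d by (simp add: power_mult)
  then have "k mod d = 0"
    using least[of "k mod d"] d by (cases "k mod d = 0") auto
  then show "z \<in> (\<Union>d\<in>{d. d dvd k}. primitive_roots_unity d)"
    using d least by (auto simp: primitive_roots_unity_def intro!: exI[of _ d])
next
  fix z assume "z \<in> (\<Union>d\<in>{d. d dvd k}. primitive_roots_unity d)"
  then show "z \<in> {z. z ^ k = 1}"
    by (auto simp: primitive_roots_unity_def power_mult)
qed

lemma primitive_roots_unity_disjoint: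
  assumes "d > 0" "e > 0" "d \<noteq> e"
  shows "primitive_roots_unity d \<inter> primitive_roots_unity e = {}"
proof (intro equals0I)
  fix z assume z: "z \<in> primitive_roots_unity d \<inter> primitive_roots_unity e"
  then have 1: "z ^ d = 1" "z ^ e = 1"
    by (simp_all add: primitive_roots_unity_def)
  have 2: "z ^ j \<noteq> 1" if "0 < j" "j < d \<or> j < e" for j
    using z that by (auto simp add: primitive_roots_unity_def)
  show False
    using 1 2[of d] 2[of e] assms by linarith
qed

lemma prod_roots_unity:
  assumes "k > 0"
  shows "(\<Prod>z\<in>{z::complex. z ^ k = 1}. [:- z, 1:]) = monom 1 k - 1"
proof -
  let ?R = "{z::complex. z ^ k = 1}"
  let ?P = "\<Prod>z\<in>?R. [:- z, 1:]"
  have fin: "finite ?R" and card: "card ?R = k"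
    using assms by (auto intro: finite_roots_unity card_roots_unity_eq)
  have deg: "degree ?P = k"
    by (subst degree_prod_eq_sum_degree) (auto simp: card)
  have lead: "coeff ?P k = 1"
    using lead_coeff_prod[of "\<lambda>z::complex. [:- z, 1:]" ?R] deg by simp
  have deg': "degree (?P - (monom 1 k - 1)) < k"
  proof (rule degree_lessI)
    show "?P - (monom 1 k - 1) \<noteq> 0 \<or> 0 < k" using assms by simp
    show "\<forall>i\<ge>k. coeff (?P - (monom 1 k - 1)) i = 0"
    proof (intro allI impI)
      fix i assume "k \<le> i"
      then show "coeff (?P - (monom 1 k - 1)) i = 0"
        using lead deg assms coeff_eq_0[of ?P i] by (cases "i = k") simp_all
    qed
  qed
  have "?P - (monom 1 k - 1) = 0"
  proof (rule ccontr)
    assume ne: "?P - (monom 1 k - 1) \<noteq> 0"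
    have "?R \<subseteq> {z. poly (?P - (monom 1 k - 1)) z = 0}"
      using fin by (auto simp: poly_monom poly_prod)
    then have "k \<le> card {z. poly (?P - (monom 1 k - 1)) z = 0}"
      using card card_mono[OF poly_roots_finite[OF ne]] by metis
    with card_poly_roots_bound[OF ne] deg' show False by linarith
  qed
  then show ?thesis by simp
qed

lemma cyclotomic_exists:
  assumes "k > 0"
  shows "\<exists>p::int poly. lead_coeff p = 1 \<and>
           map_poly of_int p = (\<Prod>z\<in>primitive_roots_unity k. [:- z, 1:])"
  using assms
proof (induction k rule: less_induct)
  case (less k)
  let ?c = "\<lambda>k. \<Prod>z\<in>primitive_roots_unity k. [:- z, 1:]"
  let ?S = "{d. d dvd k \<and> d \<noteq> k}"
  have lt: "0 < d \<and> d < k" if "d \<in> ?S" for d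
    using that less.prems dvd_imp_le[of d k] dvd_pos_nat[of k d] by force
  have "\<forall>d\<in>?S. \<exists>p::int poly. lead_coeff p = 1 \<and> map_poly of_int p = ?c d"
    using less.IH lt by blast
  then obtain f :: "nat \<Rightarrow> int poly"
    where f: "\<And>d. d \<in> ?S \<Longrightarrow> lead_coeff (f d) = 1 \<and> map_poly of_int (f d) = ?c d"
    by metis
  define P where "P = (\<Prod>d\<in>?S. f d)"
  have leadP: "lead_coeff P = 1"
    unfolding P_def lead_coeff_prod using f by (intro prod.neutral) auto
  then have P0: "P \<noteq> 0" by auto
  have finS: "finite ?S" using less.prems by (auto intro: finite_subset[OF _ finite_divisors_nat])
  have "monom 1 k - 1 = (\<Prod>d\<in>{d. d dvd k}. ?c d)"
    unfolding prod_roots_unity[OF less.prems, symmetric] roots_unity_conv_primitive[OF less.prems]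
  proof (rule prod.UNION_disjoint)
    show "finite {d. d dvd k}"
      using less.prems by (rule finite_divisors_nat)
    show "\<forall>d\<in>{d. d dvd k}. finite (primitive_roots_unity d)"
      using less.prems dvd_pos_nat[of k] finite_primitive_roots_unity by blast
    show "\<forall>d\<in>{d. d dvd k}. \<forall>e\<in>{d. d dvd k}. d \<noteq> e \<longrightarrow>
        primitive_roots_unity d \<inter> primitive_roots_unity e = {}"
      using less.prems dvd_pos_nat[of k] primitive_roots_unity_disjoint by simp
  qed
  also have "{d. d dvd k} = insert k ?S" by auto
  also have "(\<Prod>d\<in>insert k ?S. ?c d) = ?c k * (\<Prod>d\<in>?S. ?c d)"
    using finS by simp
  also have "(\<Prod>d\<in>?S. ?c d) = map_poly of_int P"
    unfolding P_def map_poly_of_int_prod using f by simp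
  finally have eq: "monom 1 k - 1 = ?c k * map_poly of_int P" .
  obtain q r where qr: "pseudo_divmod (monom 1 k - 1) P = (q, r)" by force
  have div: "monom 1 k - 1 = P * q + r" and r: "r = 0 \<or> degree r < degree P"
    using pseudo_divmod[OF P0 qr] leadP by auto
  have "map_poly of_int (monom 1 k - 1 :: int poly) = (monom 1 k - 1 :: complex poly)"
    by (rule poly_eqI) (simp add: coeff_map_poly)
  moreover have "map_poly of_int (P * q + r) =
      map_poly of_int P * map_poly of_int q + (map_poly of_int r :: complex poly)"
    unfolding map_poly_of_int_mult[symmetric] by (rule poly_eqI) (simp add: coeff_map_poly)
  ultimately have eq2:
    "map_poly of_int P * (?c k - map_poly of_int q) = (map_poly of_int r :: complex poly)"
    using eq div by (simp add: algebra_simps)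
  have dg: "degree (map_poly of_int p :: complex poly) = degree p" for p :: "int poly"
    by (rule degree_map_poly) auto
  have "?c k - map_poly of_int q = 0"
  proof (rule ccontr)
    assume ne: "?c k - map_poly of_int q \<noteq> 0"
    have P0': "map_poly of_int P \<noteq> (0 :: complex poly)"
      using P0 by (simp add: map_poly_eq_0_iff)
    have "(map_poly of_int r :: complex poly) \<noteq> 0"
      using eq2 ne P0' by (metis mult_eq_0_iff)
    then have "r \<noteq> 0" by auto
    moreover have "degree P \<le> degree r"
      using eq2 degree_mult_eq[OF P0' ne] dg by (metis le_add1)
    ultimately show False using r by simp
  qed
  then have q: "map_poly of_int q = ?c k" by simp
  have "of_int (lead_coeff q) = (lead_coeff (map_poly of_int q) :: complex)"
    by (simp add: dg coeff_map_poly)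
  also have "\<dots> = 1"
    unfolding q lead_coeff_prod by simp
  finally have "lead_coeff q = 1" by simp
  with q show ?case by blast
qed

lemma cyclotomic_spec:
  assumes "k > 0"
  shows "map_poly of_int (cyclotomic k) = (\<Prod>z\<in>primitive_roots_unity k. [:- z, 1:])"
  unfolding cyclotomic_def
proof (rule theI')
  have "p = q" if "map_poly of_int p = (map_poly of_int q :: complex poly)" for p q :: "int poly"
    using that by (simp add: poly_eq_iff coeff_map_poly)
  with cyclotomic_exists[OF assms]
  show "\<exists>!p. map_poly of_int p = (\<Prod>z\<in>primitive_roots_unity k. [:- z, 1:])"
    by metis
qed

end

theory Submission
  imports
    Defs
    "HOL-Analysis.Complex_Transcendental"
    "Jordan_Normal_Form.Char_Poly"
begin

text \<open>Put \<open>G(y) = C(y\<^sup>2) - \<surd>n y D(y\<^sup>2)\<close>, so that \<open>G(y) G(-y) = F(y\<^sup>2)\<close>; the set \<open>R\<close> of its roots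
  consists of \<open>4n\<close>-th roots of unity. For an odd prime \<open>p\<close> not dividing \<open>n\<close>, the Frobenius congruence
  modulo \<open>p\<close> in the ring of algebraic integers and the separability of \<open>y\<^bsup>4n\<^esup> - 1\<close> modulo \<open>p\<close> show
  that \<open>z \<mapsto> (n|p) z\<^sup>p\<close> permutes \<open>R\<close>. Newton's identities put the odd power sums of \<open>R\<close> into
  \<open>\<surd>n \<int>\<close>, and they vanish when the exponent has a common factor \<open>p\<close> with \<open>n\<close>, because they lie in a
  cyclotomic field unramified at \<open>p\<close>. Hence the \<open>k\<close>-th power sum is \<open>(n|k) \<surd>n\<close> for all odd \<open>k\<close>, and
  \<open>log (G(y) / G(-y))\<close> at \<open>y = m \<surd>n\<close> is \<open>-2/m\<close> times the full series. The truncation error is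
  controlled by \<open>G(y) \<le> (x - 1)\<^sup>\<lambda>\<close>, which follows from the inequality of arithmetic and geometric
  means for the numbers \<open>|y - z|\<^sup>2\<close>.\<close>

subsection \<open>Algebraic integers\<close>

interpretation int_span: Modules.module "\<lambda>(k::int) (x::complex). of_int k * x"
  by unfold_locales (simp_all add: algebra_simps)

text \<open>Determinant trick: on the generators \<open>B\<close>, multiplication by
  \<open>u\<close> is given by an integer matrix with eigenvalue \<open>u\<close>, and its
  characteristic polynomial is monic.\<close>

lemma algebraic_int_if_stabilizes_int_span:
  fixes u :: complex
  assumes "finite B" and "b0 \<in> B" and "b0 \<noteq> 0"
    and stab: "\<And>b. b \<in> B \<Longrightarrow> u * b \<in> int_span.span B"
  shows "algebraic_int u"
proof -
  obtain bs where bs: "set bs = B" "distinct bs"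
    using finite_distinct_list[OF assms(1)] by blast
  define N where "N = length bs"
  have "\<forall>b\<in>B. \<exists>c. u * b = (\<Sum>v\<in>B. of_int (c v) * v)"
    using stab unfolding int_span.span_finite[OF assms(1)] by blast
  then obtain c where c: "\<And>b. b \<in> B \<Longrightarrow> u * b = (\<Sum>v\<in>B. of_int (c b v) * v)"
    by metis
  define A where "A = Matrix.mat N N (\<lambda>(i, j). c (bs ! i) (bs ! j))"
  define v where "v = Matrix.vec N (\<lambda>i. bs ! i)"
  have A: "A \<in> carrier_mat N N" by (simp add: A_def)
  have A': "map_mat complex_of_int A \<in> carrier_mat N N" using A by simp
  have sum_bs: "(\<Sum>b\<in>B. g b) = (\<Sum>j<N. g (bs ! j))" for g :: "complex \<Rightarrow> complex"
    using bs by (intro sum.reindex_bij_betw[symmetric]) (auto simp: N_def bij_betw_nth)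
  have "eigenvector (map_mat complex_of_int A) v u"
    unfolding eigenvector_def
  proof (intro conjI)
    show "v \<in> carrier_vec (dim_row (map_mat complex_of_int A))"
      using A by (simp add: v_def)
    obtain i where "i < N" "bs ! i = b0"
      using assms(2) bs by (auto simp: in_set_conv_nth N_def)
    then show "v \<noteq> 0\<^sub>v (dim_row (map_mat complex_of_int A))"
      using assms(3) A by (auto simp: v_def dest!: arg_cong[of _ _ "\<lambda>w. vec_index w i"])
    show "map_mat complex_of_int A *\<^sub>v v = u \<cdot>\<^sub>v v"
    proof (rule eq_vecI)
      fix i assume "i < dim_vec (u \<cdot>\<^sub>v v)"
      then have i: "i < N" by (simp add: v_def)
      then have "bs ! i \<in> B" using bs by (auto simp: N_def)
      with i show "vec_index (map_mat complex_of_int A *\<^sub>v v) i = vec_index (u \<cdot>\<^sub>v v) i"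
        by (simp add: A_def v_def scalar_prod_def c sum_bs atLeast0LessThan)
    qed (use A in \<open>simp add: v_def\<close>)
  qed
  then have "poly (char_poly (map_mat complex_of_int A)) u = 0"
    using eigenvalue_root_char_poly[OF A'] unfolding eigenvalue_def by blast
  then have "poly (map_poly of_int (char_poly A)) u = 0"
    unfolding of_int_hom.char_poly_hom[OF A] .
  moreover have "lead_coeff (char_poly A) = 1"
    using degree_monic_char_poly[OF A] by simp
  ultimately show ?thesis
    by (auto simp: algebraic_int_altdef_ipoly)
qed

lemma algebraic_int_power_in_span:
  assumes "algebraic_int (x :: complex)"
  obtains d where "d > 0" "x ^ d \<in> int_span.span ((\<lambda>i. x ^ i) ` {..<d})"
proof -
  from assms obtain p where p: "poly (map_poly of_int p) x = 0" "lead_coeff p = 1"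
    by (auto simp: algebraic_int_altdef_ipoly)
  define d where "d = degree p"
  have deg: "degree (map_poly of_int p :: complex poly) = d"
    by (simp add: d_def degree_map_poly)
  have "d > 0"
  proof (rule Nat.gr0I)
    assume "d = 0"
    then obtain a where "p = [:a:]" unfolding d_def by (auto elim: degree_eq_zeroE)
    with p show False by (simp add: map_poly_pCons)
  qed
  have "0 = (\<Sum>i\<le>d. of_int (coeff p i) * x ^ i)"
    using p(1) by (simp add: poly_altdef coeff_map_poly d_def)
  also have "\<dots> = (\<Sum>i<d. of_int (coeff p i) * x ^ i) + x ^ d"
    using p(2) by (simp add: d_def flip: lessThan_Suc_atMost)
  finally have "x ^ d = (\<Sum>i<d. of_int (- coeff p i) * x ^ i)"
    by (simp add: sum_negf eq_neg_iff_add_eq_0 add.commute)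
  also have "\<dots> \<in> int_span.span ((\<lambda>i. x ^ i) ` {..<d})"
    by (intro int_span.span_sum int_span.span_scale int_span.span_base) auto
  finally show ?thesis using that \<open>d > 0\<close> by blast
qed

lemma int_span_mult_closed:
  assumes "\<And>b. b \<in> B \<Longrightarrow> u * b \<in> int_span.span B" and "v \<in> int_span.span B"
  shows "u * v \<in> int_span.span B"
  using assms(2)
proof (induction rule: int_span.span_induct_alt)
  case base
  then show ?case by (simp add: int_span.span_zero)
next
  case (step c x y)
  have "u * (of_int c * x + y) = of_int c * (u * x) + u * y" by (simp add: algebra_simps)
  with step assms(1) show ?case by (auto intro: int_span.span_add int_span.span_scale)
qed

text \<open>The products \<open>x ^ i * y ^ j\<close> below the degrees of the monic equations
  generate \<int>[x, y]; only the top exponent has to be reduced. One span stable under both factors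
  serves sums and products alike.\<close>

lemma algebraic_int_common_span:
  assumes "algebraic_int (x :: complex)" "algebraic_int y"
  obtains B where "finite B" "1 \<in> B"
    "\<And>b. b \<in> B \<Longrightarrow> x * b \<in> int_span.span B" "\<And>b. b \<in> B \<Longrightarrow> y * b \<in> int_span.span B"
proof -
  obtain d where d: "d > 0" "x ^ d \<in> int_span.span ((\<lambda>i. x ^ i) ` {..<d})"
    using algebraic_int_power_in_span[OF assms(1)] by blast
  obtain e where e: "e > 0" "y ^ e \<in> int_span.span ((\<lambda>i. y ^ i) ` {..<e})"
    using algebraic_int_power_in_span[OF assms(2)] by blast
  define B where "B = (\<lambda>(i, j). x ^ i * y ^ j) ` ({..<d} \<times> {..<e})"
  have base: "x ^ i * y ^ j \<in> int_span.span B" if "i < d" "j < e" for i j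
    using that by (intro int_span.span_base) (auto simp: B_def)
  show ?thesis
  proof (rule that)
    show "finite B" by (simp add: B_def)
    show "1 \<in> B" using d(1) e(1) by (auto simp: B_def intro!: image_eqI[of _ _ "(0,0)"])
  next
    fix b assume "b \<in> B"
    then obtain i j where ij: "i < d" "j < e" "b = x ^ i * y ^ j" by (auto simp: B_def)
    show "x * b \<in> int_span.span B"
    proof (cases "Suc i = d")
      case True
      have "y ^ j * x ^ d \<in> int_span.span B"
        using d(2)
      proof (induction rule: int_span.span_induct_alt)
        case base
        then show ?case by (simp add: int_span.span_zero)
      next
        case (step c z w)
        then have "y ^ j * z \<in> int_span.span B"
          using base ij(2) by (auto simp: mult.commute)
        then have "of_int c * (y ^ j * z) + y ^ j * w \<in> int_span.span B"
          using step by (intro int_span.span_add int_span.span_scale) auto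
        then show ?case by (simp add: algebra_simps)
      qed
      then show ?thesis using ij(3) True[symmetric] by (simp add: mult_ac)
    next
      case False
      with ij show ?thesis using base[of "Suc i" j] by (simp add: mult_ac)
    qed
    show "y * b \<in> int_span.span B"
    proof (cases "Suc j = e")
      case True
      have "x ^ i * y ^ e \<in> int_span.span B"
        using e(2)
      proof (induction rule: int_span.span_induct_alt)
        case base
        then show ?case by (simp add: int_span.span_zero)
      next
        case (step c z w)
        then have "x ^ i * z \<in> int_span.span B"
          using base ij(1) by auto
        then have "of_int c * (x ^ i * z) + x ^ i * w \<in> int_span.span B"
          using step by (intro int_span.span_add int_span.span_scale) auto
        then show ?case by (simp add: algebra_simps)
      qed
      then show ?thesis using ij(3) True[symmetric] by (simp add: mult_ac)
    next
      case False
      with ij show ?thesis using base[of i "Suc j"] by (simp add: mult_ac)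
    qed
  qed
qed

lemma algebraic_int_plus_complex:
  assumes "algebraic_int (x :: complex)" "algebraic_int y"
  shows "algebraic_int (x + y)"
proof -
  obtain B where B: "finite B" "1 \<in> B"
    "\<And>b. b \<in> B \<Longrightarrow> x * b \<in> int_span.span B" "\<And>b. b \<in> B \<Longrightarrow> y * b \<in> int_span.span B"
    using algebraic_int_common_span[OF assms] by blast
  show ?thesis
    by (rule algebraic_int_if_stabilizes_int_span[OF B(1,2)])
       (use B(3,4) in \<open>auto simp: distrib_right intro: int_span.span_add\<close>)
qed

lemma algebraic_int_times_complex:
  assumes "algebraic_int (x :: complex)" "algebraic_int y"
  shows "algebraic_int (x * y)"
proof -
  obtain B where B: "finite B" "1 \<in> B"
    "\<And>b. b \<in> B \<Longrightarrow> x * b \<in> int_span.span B" "\<And>b. b \<in> B \<Longrightarrow> y * b \<in> int_span.span B"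
    using algebraic_int_common_span[OF assms] by blast
  show ?thesis
    by (rule algebraic_int_if_stabilizes_int_span[OF B(1,2)])
       (use B(3,4) in \<open>auto simp: mult.assoc intro: int_span_mult_closed\<close>)
qed

lemma algebraic_int_power_complex:
  "algebraic_int (x :: complex) \<Longrightarrow> algebraic_int (x ^ k)"
  by (induction k) (auto intro: algebraic_int_times_complex)

lemma algebraic_int_sum_complex:
  "(\<And>i. i \<in> A \<Longrightarrow> algebraic_int (f i :: complex)) \<Longrightarrow> algebraic_int (sum f A)"
  by (induction A rule: infinite_finite_induct) (auto intro: algebraic_int_plus_complex)

lemma algebraic_int_prod_complex:
  "(\<And>i. i \<in> A \<Longrightarrow> algebraic_int (f i :: complex)) \<Longrightarrow> algebraic_int (prod f A)"
  by (induction A rule: infinite_finite_induct) (auto intro: algebraic_int_times_complex)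

lemma algebraic_int_minus_complex:
  assumes "algebraic_int (x :: complex)" "algebraic_int y"
  shows "algebraic_int (x - y)"
  using algebraic_int_plus_complex[of x "- y"] assms by simp

lemma algebraic_int_of_int_poly:
  assumes "algebraic_int (x :: complex)"
  shows "algebraic_int (poly (map_poly of_int p) x)"
  by (induction p)
     (auto simp: map_poly_pCons intro!: algebraic_int_plus_complex algebraic_int_times_complex assms)

lemma algebraic_int_root_unity:
  assumes "(x :: complex) ^ N = 1" "N > 0"
  shows "algebraic_int x"
proof (rule algebraic_int_root)
  show "poly (monom 1 N) x = 1" using assms by (simp add: poly_monom)
qed (use assms in \<open>auto simp: degree_monom_eq\<close>)

text \<open>The quotient is rational and an algebraic integer, hence an integer. This brings
  divisibility among algebraic integers back to \<int>.\<close>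

lemma int_dvd_if_algebraic_int:
  assumes "algebraic_int u" and "of_int c = of_int q * (u :: complex)" and "q \<noteq> 0"
  shows "q dvd c"
proof -
  have "u = of_int c / of_int q" using assms by (simp add: field_simps)
  then have "u \<in> \<rat>" by simp
  with assms(1) have "u \<in> \<int>" by (rule rational_algebraic_int_is_int)
  then obtain k where "u = of_int k" by (auto elim: Ints_cases)
  with assms(2) have "of_int c = (of_int (q * k) :: complex)" by simp
  then show ?thesis unfolding of_int_eq_iff by simp
qed

subsection \<open>Congruences modulo a prime\<close>

text \<open>The error term is kept explicit, so that it can be recognised later as an algebraic
  integer or as an integer polynomial.\<close>

lemma binomial_prime_power:
  fixes a b :: "'a :: comm_ring_1"
  assumes "prime p"
  shows "(a + b) ^ p = a ^ p + b ^ p +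
    of_nat p * (\<Sum>k\<in>{0<..<p}. of_nat ((p choose k) div p) * a ^ k * b ^ (p - k))"
proof -
  have p: "p > 0" using assms by (rule prime_gt_0_nat)
  have "(a + b) ^ p = (\<Sum>k\<le>p. of_nat (p choose k) * a ^ k * b ^ (p - k))"
    by (rule binomial_ring)
  also have "{..p} = insert 0 (insert p {0<..<p})" using p by auto
  also have "(\<Sum>k\<in>\<dots>. of_nat (p choose k) * a ^ k * b ^ (p - k)) =
      a ^ p + b ^ p + (\<Sum>k\<in>{0<..<p}. of_nat (p choose k) * a ^ k * b ^ (p - k))"
    using p by simp
  also have "(\<Sum>k\<in>{0<..<p}. of_nat (p choose k) * a ^ k * b ^ (p - k)) =
      of_nat p * (\<Sum>k\<in>{0<..<p}. of_nat ((p choose k) div p) * a ^ k * b ^ (p - k))"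
    unfolding sum_distrib_left
  proof (rule sum.cong)
    fix k assume "k \<in> {0<..<p}"
    then have "p dvd (p choose k)"
      using assms by (intro dvd_choose_prime) auto
    then have "p choose k = p * ((p choose k) div p)" by simp
    then have "of_nat (p choose k) = (of_nat p * of_nat ((p choose k) div p) :: 'a)"
      by (metis of_nat_mult)
    then show "of_nat (p choose k) * a ^ k * b ^ (p - k) =
        of_nat p * (of_nat ((p choose k) div p) * a ^ k * b ^ (p - k))"
      by (simp add: mult.assoc)
  qed simp
  finally show ?thesis .
qed

lemma prime_dvd_power_diff_self_int:
  assumes "prime p"
  shows "int p dvd a ^ p - a"
proof -
  have nat: "int p dvd int b ^ p - int b" for b :: nat
  proof (induction b)
    case 0
    show ?case using prime_gt_0_nat[OF assms] by (simp add: power_0_left)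
  next
    case (Suc b)
    have "int (Suc b) ^ p - int (Suc b) = int b ^ p - int b +
      int p * (\<Sum>k\<in>{0<..<p}. of_nat ((p choose k) div p) * int b ^ k * 1 ^ (p - k))"
      using binomial_prime_power[OF assms, of "int b" 1] by (simp add: add_ac)
    then show ?case using Suc by (simp only: dvd_add dvd_triv_left)
  qed
  \<comment> \<open>Negative \<open>a\<close> is replaced by its nonnegative residue, to which the
    induction applies.\<close>
  have "[a ^ p - a = int (nat (a mod int p)) ^ p - int (nat (a mod int p))] (mod int p)"
    using prime_gt_0_nat[OF assms] by (intro cong_diff cong_pow) (auto simp: cong_def)
  then show ?thesis using nat cong_dvd_iff by blast
qed

text \<open>Frobenius on \<int>[X] modulo \<open>p\<close>: the mixed binomial terms vanish and
  Fermat's little theorem fixes the coefficients.\<close>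

lemma poly_power_prime_cong:
  fixes f :: "int poly"
  assumes "prime p"
  shows "\<exists>g. f ^ p = pcompose f (monom 1 p) + of_nat p * g"
proof (induction f)
  case 0
  then show ?case using prime_gt_0_nat[OF assms] by (auto intro: exI[of _ 0])
next
  case (pCons a f)
  then obtain g where g: "f ^ p = pcompose f (monom 1 p) + of_nat p * g" by blast
  obtain c where "a ^ p - a = int p * c"
    using prime_dvd_power_diff_self_int[OF assms, of a] by (rule dvdE)
  then have c: "a ^ p = a + int p * c" by linarith
  obtain h where h: "([:a:] + [:0, 1:] * f) ^ p =
      [:a:] ^ p + ([:0, 1:] * f) ^ p + of_nat p * h"
    using binomial_prime_power[OF assms] by blast
  have "[:a:] ^ p = [:a:] + of_nat p * [:c:]"
    using c by (simp add: poly_const_pow of_nat_poly)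
  moreover have "[:0, 1:] ^ p = (monom 1 p :: int poly)"
    by (metis monom_altdef smult_1_left)
  moreover have "pCons a f ^ p = ([:a:] + [:0, 1:] * f) ^ p" by simp
  ultimately have "pCons a f ^ p = pcompose (pCons a f) (monom 1 p) +
      of_nat p * ([:c:] + monom 1 p * g + h)"
    using h g by (simp only: pcompose_pCons) (simp add: power_mult_distrib algebra_simps del: mult_pCons_left mult_pCons_right)
  then show ?case by blast
qed

lemma algebraic_int_binomial_prime_power:
  fixes a b :: complex
  assumes "prime p" "algebraic_int a" "algebraic_int b"
  shows "\<exists>h. algebraic_int h \<and> (a + b) ^ p = a ^ p + b ^ p + of_nat p * h"
proof (intro exI conjI)
  show "(a + b) ^ p = a ^ p + b ^ p +
      of_nat p * (\<Sum>k\<in>{0<..<p}. of_nat ((p choose k) div p) * a ^ k * b ^ (p - k))"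
    by (rule binomial_prime_power[OF assms(1)])
  show "algebraic_int (\<Sum>k\<in>{0<..<p}. of_nat ((p choose k) div p) * a ^ k * b ^ (p - k))"
    using int_imp_algebraic_int[OF Ints_of_nat] assms(2,3)
    by (intro algebraic_int_sum_complex algebraic_int_times_complex algebraic_int_power_complex)
qed

text \<open>The derivative of \<open>y ^ N - 1\<close> at a root, computed in two ways. It expresses
  separability modulo every prime not dividing \<open>N\<close>.\<close>

lemma prod_diff_roots_unity:
  fixes \<xi> :: complex
  assumes "\<xi> ^ N = 1" "N > 0"
  shows "(\<Prod>\<eta>\<in>{z. z ^ N = 1} - {\<xi>}. \<xi> - \<eta>) = of_nat N * \<xi> ^ (N - 1)"
proof -
  let ?Q = "\<Prod>\<eta>\<in>{z::complex. z ^ N = 1} - {\<xi>}. [:- \<eta>, 1:]"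
  have "[:- \<xi>, 1:] * ?Q = (\<Prod>\<eta>\<in>{z::complex. z ^ N = 1}. [:- \<eta>, 1:])"
    using assms by (subst prod.remove[of _ \<xi>]) (auto intro: finite_roots_unity)
  also have "\<dots> = monom 1 N - 1" by (rule prod_roots_unity[OF assms(2)])
  finally have "poly (pderiv ([:- \<xi>, 1:] * ?Q)) \<xi> = poly (pderiv (monom 1 N - 1)) \<xi>" by simp
  then have "poly ?Q \<xi> = of_nat N * \<xi> ^ (N - 1)"
    by (simp add: pderiv_mult pderiv_pCons pderiv_diff pderiv_monom poly_monom del: mult_pCons_left)
  then show ?thesis by (simp add: poly_prod)
qed

subsection \<open>Degree and roots of the polynomial F\<close>

text \<open>Both functions have divisor sum \<open>k\<close>, so strong induction on the proper
  divisors makes them equal.\<close>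

lemma card_primitive_roots_unity:
  "k > 0 \<Longrightarrow> card (primitive_roots_unity k) = totient k"
proof (induction k rule: less_induct)
  case (less k)
  let ?S = "{d. d dvd k} - {k}"
  have fin: "finite {d. d dvd k}" using less.prems by simp
  have pos: "d > 0" if "d dvd k" for d using that less.prems by (auto intro: Nat.gr0I)
  have "k = card {z::complex. z ^ k = 1}"
    using less.prems by (simp add: card_roots_unity_eq)
  also have "\<dots> = (\<Sum>d | d dvd k. card (primitive_roots_unity d))"
    unfolding roots_unity_conv_primitive[OF less.prems]
    using fin pos by (intro card_UN_disjoint)
      (auto simp: finite_primitive_roots_unity primitive_roots_unity_disjoint)
  also have "\<dots> = card (primitive_roots_unity k) + (\<Sum>d\<in>?S. card (primitive_roots_unity d))"
    using fin by (intro sum.remove) auto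
  also have "(\<Sum>d\<in>?S. card (primitive_roots_unity d)) = (\<Sum>d\<in>?S. totient d)"
  proof (rule sum.cong)
    fix d assume d: "d \<in> ?S"
    then have "d < k" using less.prems dvd_imp_le[of d k] by force
    then show "card (primitive_roots_unity d) = totient d" using less.IH[of d] d pos by auto
  qed simp
  finally have "k = card (primitive_roots_unity k) + (\<Sum>d\<in>?S. totient d)" .
  moreover have "k = totient k + (\<Sum>d\<in>?S. totient d)"
    using fin totient_divisor_sum[of k] by (subst (asm) sum.remove[of _ k]) auto
  ultimately show ?case by linarith
qed

lemma degree_cyclotomic:
  assumes "k > 0"
  shows "degree (cyclotomic k) = totient k"
proof -
  have "degree (cyclotomic k) = degree (map_poly of_int (cyclotomic k) :: complex poly)"
    by (simp add: degree_map_poly)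
  also have "\<dots> = totient k"
    unfolding cyclotomic_spec[OF assms]
    by (subst degree_prod_eq_sum_degree) (auto simp: card_primitive_roots_unity[OF assms])
  finally show ?thesis .
qed

lemma cyclotomic_cofactor:
  assumes "k > 0"
  obtains Q :: "complex poly"
  where "\<And>z. poly (map_poly of_int (cyclotomic k)) z * poly Q z = z ^ k - 1"
proof
  let ?U = "{z::complex. z ^ k = 1}" and ?P = "primitive_roots_unity k"
  fix z
  have "(\<Prod>z\<in>?P. [:- z, 1:]) * (\<Prod>z\<in>?U - ?P. [:- z, 1:]) = (\<Prod>z\<in>?U. [:- z, 1:])"
    using assms by (subst mult.commute, subst prod.subset_diff[symmetric])
      (auto simp: primitive_roots_unity_def intro: finite_roots_unity)
  then have "poly ((\<Prod>z\<in>?P. [:- z, 1:]) * (\<Prod>z\<in>?U - ?P. [:- z, 1:])) z = poly (monom 1 k - 1) z"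
    using prod_roots_unity[OF assms] by simp
  then show "poly (map_poly of_int (cyclotomic k)) z * poly (\<Prod>z\<in>?U - ?P. [:- z, 1:]) z = z ^ k - 1"
    by (simp add: cyclotomic_spec[OF assms] poly_monom)
qed

lemma squarefree_even_nat:
  assumes "squarefree (n :: nat)" "even n"
  obtains k where "n = 2 * k" "odd k"
proof -
  obtain k where k: "n = 2 * k" using assms(2) by blast
  have "odd k"
  proof
    assume "even k"
    then have "2\<^sup>2 dvd n" using k by (auto simp: power2_eq_square)
    with assms(1) have "(2::nat) dvd 1" unfolding squarefree_def by blast
    then show False by simp
  qed
  with k that show ?thesis by blast
qed

lemma aurif_sign_cases: "aurif_sign n = 1 \<or> aurif_sign n = - 1"
  by (simp add: aurif_sign_def)

lemma degree_aurif_F: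
  assumes "squarefree n" "n > 1"
  shows "degree (aurif_F n) = totient (2 * n)"
proof (cases "odd n")
  case True
  with assms show ?thesis
    using aurif_sign_cases[of n]
    by (auto simp: aurif_F_def degree_pcompose degree_cyclotomic totient_double)
next
  case False
  then obtain k where k: "n = 2 * k" "odd k"
    using squarefree_even_nat assms(1) by blast
  have "degree (aurif_F n) = 2 * degree (cyclotomic k)"
    using k by (cases "even (totient k)") (simp_all add: aurif_F_def degree_pcompose)
  then show ?thesis
    using k odd_pos[OF k(2)] totient_double[of "2 * k"] by (simp add: degree_cyclotomic totient_double)
qed

text \<open>For odd \<open>n\<close> with sign \<open>s\<close>, F(y^2) divides (s y^2)^n - 1 = s
  y^(2n) - 1, and the factor s y^(2n) + 1 completes y^(4n) - 1. For even \<open>n\<close> the same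
  works with - y^(2n) - 1 and 1 - y^(2n).\<close>

lemma poly_aurif_F_cofactor:
  assumes "squarefree n" "n > 1"
  obtains q :: "complex poly"
  where "\<And>y. poly (map_poly of_int (aurif_F n)) (y\<^sup>2) * poly q y = y ^ (4 * n) - 1"
proof (cases "odd n")
  case True
  define s :: complex where "s = of_int (aurif_sign n)"
  have s: "s ^ n = s" "s\<^sup>2 = 1"
    using aurif_sign_cases[of n] True by (auto simp: s_def)
  obtain Q :: "complex poly"
    where Q: "\<And>z. poly (map_poly of_int (cyclotomic n)) z * poly Q z = z ^ n - 1"
    using cyclotomic_cofactor[of n] assms by auto
  have F: "poly (map_poly of_int (aurif_F n)) z = poly (map_poly of_int (cyclotomic n)) (s * z)" for z
    using True by (simp add: aurif_F_def of_int_hom.map_poly_pcompose poly_pcompose s_def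
        of_int_hom.map_poly_pCons_hom mult.commute)
  show ?thesis
  proof (rule that)
    fix y :: complex
    have "poly (map_poly of_int (aurif_F n)) (y\<^sup>2) *
        poly (pcompose Q (monom s 2) * (monom s (2 * n) + 1)) y =
        ((s * y\<^sup>2) ^ n - 1) * (s * y ^ (2 * n) + 1)"
      by (simp add: F poly_pcompose poly_monom mult.assoc[symmetric] Q)
    also have "\<dots> = s\<^sup>2 * (y ^ (2 * n))\<^sup>2 - 1"
      by (simp add: power_mult_distrib s(1) power_mult algebra_simps power2_eq_square)
    also have "\<dots> = y ^ (4 * n) - 1"
      by (simp add: s(2) flip: power_mult)
    finally show "poly (map_poly of_int (aurif_F n)) (y\<^sup>2) *
        poly (pcompose Q (monom s 2) * (monom s (2 * n) + 1)) y = y ^ (4 * n) - 1" .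
  qed
next
  case False
  then obtain k where k: "n = 2 * k" "odd k"
    using squarefree_even_nat assms(1) by blast
  define s :: complex where "s = (- 1) ^ totient k"
  have s: "s * s = 1" by (simp add: s_def flip: power_mult_distrib)
  obtain Q :: "complex poly"
    where Q: "\<And>z. poly (map_poly of_int (cyclotomic k)) z * poly Q z = z ^ k - 1"
    using cyclotomic_cofactor[of k] k odd_pos by blast
  have F: "poly (map_poly of_int (aurif_F n)) z = s * poly (map_poly of_int (cyclotomic k)) (- z\<^sup>2)" for z
    using k by (simp add: aurif_F_def of_int_hom.map_poly_pcompose poly_pcompose s_def
        of_int_hom.map_poly_pCons_hom power2_eq_square of_int_hom.map_poly_hom_smult)
  show ?thesis
  proof (rule that)
    fix y :: complex
    have "poly (map_poly of_int (aurif_F n)) (y\<^sup>2) *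
        poly (smult s (pcompose Q (monom (- 1) 4) * (1 - monom 1 (2 * n)))) y =
        (s * s) * (poly (map_poly of_int (cyclotomic k)) (- (y ^ 4)) * poly Q (- (y ^ 4))) * (1 - y ^ (2 * n))"
      by (simp add: F poly_pcompose poly_monom mult_ac flip: power_mult)
    also have "\<dots> = ((- (y ^ 4)) ^ k - 1) * (1 - y ^ (2 * n))"
      by (simp add: s Q)
    also have "(- (y ^ 4)) ^ k = - (y ^ (2 * n))"
      using k by (simp add: power_minus_odd flip: power_mult)
    also have "(- (y ^ (2 * n)) - 1) * (1 - y ^ (2 * n)) = (y ^ (2 * n))\<^sup>2 - 1"
      by (simp add: algebra_simps power2_eq_square)
    also have "\<dots> = y ^ (4 * n) - 1" by (simp flip: power_mult)
    finally show "poly (map_poly of_int (aurif_F n)) (y\<^sup>2) *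
        poly (smult s (pcompose Q (monom (- 1) 4) * (1 - monom 1 (2 * n)))) y = y ^ (4 * n) - 1" .
  qed
qed

lemma coeff_pcompose_monom_2:
  fixes p :: "'a :: comm_ring_1 poly"
  shows "coeff (pcompose p (monom 1 2)) k = (if even k then coeff p (k div 2) else 0)"
proof (induction p arbitrary: k)
  case (pCons a p)
  show ?case
  proof (cases "k < 2")
    case True
    then have "k = 0 \<or> k = 1" by linarith
    then show ?thesis by (auto simp: pcompose_pCons coeff_monom_mult)
  next
    case False
    then obtain j where "k = Suc (Suc j)" by (metis add_2_eq_Suc le_Suc_ex not_less)
    then show ?thesis by (simp add: pcompose_pCons coeff_monom_mult pCons.IH)
  qed
qed simp

text \<open>An inverse of \<open>k\<close> modulo \<open>N\<close> recovers an N-th root of unity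
  from its k-th power.\<close>

lemma eq_if_coprime_powers_eq:
  fixes a b :: "'a :: field"
  assumes "a ^ N = 1" "b ^ N = 1" "a ^ k = b ^ k" "coprime k N"
  shows "a = b"
proof (cases "N = 0 \<or> N = 1")
  case True
  with assms show ?thesis by auto
next
  case False
  obtain x where "[k * x = Suc 0] (mod N)"
    using cong_solve_coprime_nat[OF assms(4)] by (rule exE)
  then have "(k * x) mod N = 1" using False by (simp add: cong_def)
  then have kx: "k * x = 1 + N * (k * x div N)"
    using mult_div_mod_eq[of N "k * x"] by linarith
  have "c ^ (k * x) = c" if "c ^ N = 1" for c :: 'a
    by (subst kx) (simp add: power_mult that)
  then show ?thesis
    using assms by (metis power_mult)
qed

lemma coprime_odd_prime_4_mult:
  fixes p n :: nat
  assumes "prime p" "odd p" "\<not> p dvd n"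
  shows "coprime p (4 * n)"
proof (rule prime_imp_coprime[OF assms(1)], rule notI)
  assume "p dvd 4 * n"
  then have "p dvd 2 * (2 * n)" by simp
  then have "p dvd 2"
    using assms(1,3) by (simp only: prime_dvd_mult_iff) blast
  then have "p = 2" using assms(1) two_is_prime_nat primes_dvd_imp_eq by blast
  with assms(2) show False by simp
qed

subsection \<open>The roots of an Aurifeuillian factor\<close>

locale aurifeuillian_pair =
  fixes n :: nat and C D :: "int poly"
  assumes n_gt_1: "n > 1" and squarefree_n: "squarefree n" and pair: "is_aurif_pair n C D"
begin

definition lam :: nat where "lam = totient (2 * n) div 2"

definition r :: complex where "r = of_real (sqrt (real n))"

text \<open>The substitution of y^2 makes both factors values of one polynomial: at y = m \<surd>n
  and at its negative.\<close>

definition G :: "complex poly" where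
  "G = pcompose (map_poly of_int C) (monom 1 2) -
       monom r 1 * pcompose (map_poly of_int D) (monom 1 2)"

definition R :: "complex set" where "R = {z. poly G z = 0}"

definition P :: "nat \<Rightarrow> complex" where "P k = (\<Sum>z\<in>R. z ^ k)"

lemma r_squared: "r\<^sup>2 = of_nat n"
  by (simp add: r_def flip: of_real_power)

lemma poly_G:
  "poly G y = poly (map_poly of_int C) (y\<^sup>2) - r * y * poly (map_poly of_int D) (y\<^sup>2)"
  by (simp add: G_def poly_pcompose poly_monom)

lemma lead_C: "lead_coeff C = 1" and lead_D: "lead_coeff D = 1"
  and F_eq: "aurif_F n = C\<^sup>2 - [:0, int n:] * D\<^sup>2"
  using pair by (auto simp: is_aurif_pair_def)

lemma poly_F_eq:
  "poly (map_poly of_int (aurif_F n)) z =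
     (poly (map_poly of_int C) z)\<^sup>2 - of_nat n * z * (poly (map_poly of_int D) z)\<^sup>2" for z :: complex
  unfolding F_eq of_int_poly_hom.hom_minus of_int_poly_hom.hom_mult of_int_poly_hom.hom_power
  by (simp add: of_int_hom.map_poly_pCons_hom)

lemma poly_G_mult_poly_G_minus: "poly G y * poly G (- y) = poly (map_poly of_int (aurif_F n)) (y\<^sup>2)"
proof -
  have "poly G y * poly G (- y) = (poly (map_poly of_int C) (y\<^sup>2))\<^sup>2 -
      r\<^sup>2 * y\<^sup>2 * (poly (map_poly of_int D) (y\<^sup>2))\<^sup>2"
    by (simp add: poly_G algebra_simps power2_eq_square)
  then show ?thesis by (simp add: r_squared poly_F_eq)
qed

lemma two_lam: "2 * lam = totient (2 * n)"
  using n_gt_1 totient_even[of "2 * n"] by (simp add: lam_def)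

lemma lam_pos: "lam > 0"
  using two_lam n_gt_1 by (metis mult_0_right nat_0_less_mult_iff neq0_conv not_less_zero
      totient_gt_0_iff zero_less_numeral zero_less_one order_less_trans)

text \<open>The two terms of F have degrees of opposite parity, so their leading terms cannot
  cancel; as F has even degree, the square of \<open>C\<close> dominates.\<close>

lemma degree_C: "degree C = lam" and degree_D: "degree D < lam"
proof -
  have C0: "C \<noteq> 0" and D0: "D \<noteq> 0" using lead_C lead_D by auto
  let ?B = "[:0, int n:] * D\<^sup>2"
  have dA: "degree (C\<^sup>2) = 2 * degree C" using C0 by (simp add: degree_power_eq)
  have dB: "degree ?B = Suc (2 * degree D)"
    using D0 n_gt_1 by (subst degree_mult_eq) (auto simp: degree_power_eq)
  have dF: "degree (C\<^sup>2 - ?B) = 2 * lam"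
    using degree_aurif_F[OF squarefree_n n_gt_1] by (simp add: two_lam F_eq)
  have lt: "degree ?B < degree (C\<^sup>2)"
  proof (rule ccontr)
    assume "\<not> degree ?B < degree (C\<^sup>2)"
    moreover have "degree ?B \<noteq> degree (C\<^sup>2)" unfolding dA dB by presburger
    ultimately have "degree (C\<^sup>2) < degree ?B" by linarith
    then have "degree (- ?B + C\<^sup>2) = degree (- ?B)"
      by (intro degree_add_eq_left) (simp only: degree_minus)
    moreover have "- ?B + C\<^sup>2 = C\<^sup>2 - ?B" by simp
    ultimately have "2 * lam = Suc (2 * degree D)"
      using dF dB by (metis degree_minus)
    then show False by presburger
  qed
  then have "degree (C\<^sup>2 + - ?B) = degree (C\<^sup>2)"
    by (intro degree_add_eq_left) (simp only: degree_minus)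
  moreover have "C\<^sup>2 + - ?B = C\<^sup>2 - ?B" by simp
  ultimately have "2 * lam = 2 * degree C" using dF dA by metis
  then show "degree C = lam" by simp
  then show "degree D < lam" using lt dA dB by linarith
qed

lemma coeff_G:
  "coeff G k = (if even k then of_int (coeff C (k div 2)) else - r * of_int (coeff D (k div 2)))"
  unfolding G_def
  by (cases k) (auto simp: coeff_pcompose_monom_2 coeff_monom_mult coeff_map_poly poly_0_coeff_0)

lemma degree_G: "degree G = 2 * lam"
proof (rule antisym)
  have "coeff G (2 * lam) \<noteq> 0"
    using lead_C degree_C by (simp add: coeff_G)
  then show "2 * lam \<le> degree G" by (rule le_degree)
  show "degree G \<le> 2 * lam"
  proof (rule degree_le, intro allI impI)
    fix i assume "i > 2 * lam"
    then have "i div 2 > lam \<or> (odd i \<and> i div 2 \<ge> lam)" by presburger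
    then show "coeff G i = 0"
      using degree_C degree_D by (auto simp: coeff_G coeff_eq_0)
  qed
qed

lemma lead_coeff_G: "lead_coeff G = 1"
  using lead_C degree_C by (simp add: degree_G coeff_G)

lemma G_nonzero: "G \<noteq> 0"
  using lead_coeff_G by auto

text \<open>The missing factor is G(-y) times the cofactor of F(y^2).\<close>

lemma poly_G_cofactor:
  obtains H where "G * H = monom 1 (4 * n) - 1"
proof -
  obtain q :: "complex poly"
    where q: "\<And>y. poly (map_poly of_int (aurif_F n)) (y\<^sup>2) * poly q y = y ^ (4 * n) - 1"
    using poly_aurif_F_cofactor[OF squarefree_n n_gt_1] by blast
  have "poly (G * (pcompose G [:0, - 1:] * q)) = poly (monom 1 (4 * n) - 1)"
    using q by (intro ext) (simp add: poly_pcompose poly_monom mult.assoc[symmetric] poly_G_mult_poly_G_minus)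
  then show ?thesis using that by (simp only: poly_eq_poly_eq_iff) 
qed

lemma R_subset: "R \<subseteq> {z. z ^ (4 * n) = 1}"
proof
  fix z assume "z \<in> R"
  obtain H where "G * H = monom 1 (4 * n) - 1" using poly_G_cofactor .
  then have "poly G z * poly H z = z ^ (4 * n) - 1"
    by (metis poly_mult poly_diff poly_1 poly_monom mult_1)
  with \<open>z \<in> R\<close> show "z \<in> {z. z ^ (4 * n) = 1}" by (simp add: R_def)
qed

lemma finite_R: "finite R"
  unfolding R_def by (rule poly_roots_finite[OF G_nonzero])

lemma R_nonzero: "z \<in> R \<Longrightarrow> z \<noteq> 0"
  using R_subset n_gt_1 by (auto simp: power_0_left)

lemma norm_R: "z \<in> R \<Longrightarrow> norm z = 1"
  using R_subset n_gt_1 power_eq_1_iff[of z "4 * n"] by auto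

lemma rsquarefree_G: "rsquarefree G"
  unfolding rsquarefree_roots
proof (intro allI notI)
  fix a assume a: "poly G a = 0 \<and> poly (pderiv G) a = 0"
  obtain H where "G * H = monom 1 (4 * n) - 1" using poly_G_cofactor .
  then have "poly (pderiv (G * H)) a = poly (pderiv (monom 1 (4 * n) - 1)) a" by simp
  with a have "of_nat (4 * n) * a ^ (4 * n - 1) = 0"
    by (simp add: pderiv_mult pderiv_diff pderiv_monom poly_monom)
  moreover have "a \<in> R" using a by (simp add: R_def)
  then have "a \<noteq> 0" by (rule R_nonzero)
  ultimately show False using n_gt_1 by simp
qed

lemma G_eq_prod: "G = (\<Prod>z\<in>R. [:- z, 1:])"
  using complex_poly_decompose_rsquarefree[OF rsquarefree_G] lead_coeff_G by (simp add: R_def)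

lemma poly_G_eq_prod: "poly G y = (\<Prod>z\<in>R. y - z)"
  unfolding G_eq_prod by (simp add: poly_prod)

lemma card_R: "card R = 2 * lam"
proof -
  have "degree (\<Prod>z\<in>R. [:- z, 1:]) = card R"
    by (subst degree_prod_eq_sum_degree) auto
  then show ?thesis using degree_G G_eq_prod by simp
qed

lemma algebraic_int_r: "algebraic_int r"
  unfolding r_def by (intro algebraic_int_of_real algebraic_int_sqrt int_imp_algebraic_int) simp

text \<open>Modulo \<open>p\<close>, G at the image point is congruent to the p-th power of
  \<open>poly G \<zeta> = 0\<close>. If the image were no root, that value would divide the
  derivative of y^(4n) - 1 there, which forces \<open>p\<close> to divide
  \<open>4 * n\<close>.\<close>

lemma R_frobenius:
  assumes "prime p" "odd p" "\<not> p dvd n" "\<zeta> \<in> R"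
  shows "of_int (Legendre (int n) (int p)) * \<zeta> ^ p \<in> R"
proof (rule ccontr)
  define \<epsilon> where "\<epsilon> = Legendre (int n) (int p)"
  define \<xi> where "\<xi> = of_int \<epsilon> * \<zeta> ^ p"
  assume "\<not> ?thesis"
  then have nR: "\<xi> \<notin> R" by (simp add: \<xi>_def \<epsilon>_def)
  have "\<epsilon> = 1 \<or> \<epsilon> = - 1"
    using assms(3) by (auto simp: \<epsilon>_def Legendre_def cong_0_iff)
  then have eps2: "(of_int \<epsilon> :: complex)\<^sup>2 = 1" by auto
  have M0: "4 * n > 0" using n_gt_1 by simp
  have \<zeta>N: "\<zeta> ^ (4 * n) = 1" using assms(4) R_subset by auto
  have algz: "algebraic_int (\<zeta> ^ k)" for k
    using algebraic_int_root_unity[OF \<zeta>N M0] by (rule algebraic_int_power_complex)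
  have "\<xi> ^ (4 * n) = ((of_int \<epsilon>)\<^sup>2) ^ (2 * n) * (\<zeta> ^ (4 * n)) ^ p"
    by (simp add: \<xi>_def power_mult_distrib mult_ac flip: power_mult)
  then have \<xi>N: "\<xi> ^ (4 * n) = 1" by (simp only: eps2 \<zeta>N power_one mult_1)
  have \<xi>2: "\<xi>\<^sup>2 = (\<zeta>\<^sup>2) ^ p"
    using eps2 by (simp add: \<xi>_def power_mult_distrib mult.commute flip: power_mult)
  define c where "c = poly (map_poly complex_of_int C) (\<zeta>\<^sup>2)"
  define d where "d = poly (map_poly complex_of_int D) (\<zeta>\<^sup>2)"
  \<comment> \<open>Frobenius handles the integer polynomials \<open>C\<close> and \<open>D\<close>;
    the irrational factor \<open>r\<close> is treated separately below.\<close>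
  have frob: "\<exists>g. algebraic_int g \<and> poly (map_poly of_int f) ((\<zeta>\<^sup>2) ^ p) =
      poly (map_poly of_int f) (\<zeta>\<^sup>2) ^ p - of_nat p * g" for f
  proof -
    obtain g where "f ^ p = pcompose f (monom 1 p) + of_nat p * g"
      using poly_power_prime_cong[OF assms(1)] by blast
    then have "poly (map_poly of_int (f ^ p)) (\<zeta>\<^sup>2) =
        poly (map_poly of_int (pcompose f (monom 1 p) + of_nat p * g)) (\<zeta>\<^sup>2)" by simp
    then have "poly (map_poly of_int f) (\<zeta>\<^sup>2) ^ p = poly (map_poly of_int f) ((\<zeta>\<^sup>2) ^ p) +
        of_nat p * poly (map_poly of_int g) (\<zeta>\<^sup>2)"
      by (simp add: of_int_poly_hom.hom_power of_int_poly_hom.hom_add of_int_poly_hom.hom_mult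
          of_int_hom.map_poly_pcompose poly_pcompose poly_monom of_nat_poly
          of_int_hom.map_poly_pCons_hom of_int_hom.map_poly_hom_smult)
    then show ?thesis
      using algebraic_int_of_int_poly[OF algz[of 2], of g] by (auto simp: algebra_simps)
  qed
  obtain g1 where g1: "algebraic_int g1"
      "poly (map_poly of_int C) ((\<zeta>\<^sup>2) ^ p) = c ^ p - of_nat p * g1"
    using frob[of C] unfolding c_def by blast
  obtain g2 where g2: "algebraic_int g2"
      "poly (map_poly of_int D) ((\<zeta>\<^sup>2) ^ p) = d ^ p - of_nat p * g2"
    using frob[of D] unfolding d_def by blast
  have algcd: "algebraic_int c" "algebraic_int d"
    unfolding c_def d_def by (intro algebraic_int_of_int_poly algz)+
  obtain h where h: "algebraic_int h"
      "(c + - (r * \<zeta> * d)) ^ p = c ^ p + (- (r * \<zeta> * d)) ^ p + of_nat p * h"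
    using algebraic_int_binomial_prime_power[OF assms(1) algcd(1), of "- (r * \<zeta> * d)"]
      algebraic_int_times_complex algebraic_int_r algz[of 1] algcd(2) by auto
  have "c + - (r * \<zeta> * d) = 0"
    using assms(4) by (simp add: R_def poly_G c_def d_def)
  \<comment> \<open>The vanishing of G at \<open>\<zeta>\<close> is raised to the p-th power; the
    sign survives because \<open>p\<close> is odd.\<close>
  then have h0: "c ^ p = r ^ p * \<zeta> ^ p * d ^ p - of_nat p * h"
    using h(2) assms(2) prime_gt_0_nat[OF assms(1)]
    by (simp add: power_mult_distrib power_0_left algebra_simps)
  have "p > 2"
    using prime_ge_2_nat[OF assms(1)] assms(2) by (cases "p = 2") auto
  \<comment> \<open>Euler's criterion yields r^p \<equiv> \<epsilon> r modulo \<open>p\<close>,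
    which is why \<open>\<epsilon>\<close> appears in the image point.\<close>
  then have "int p dvd int n ^ ((p - 1) div 2) - \<epsilon>"
    using euler_criterion[OF assms(1), of "int n"]
    by (simp add: \<epsilon>_def cong_iff_dvd_diff dvd_diff_commute)
  then obtain l where "int n ^ ((p - 1) div 2) - \<epsilon> = int p * l" by (rule dvdE)
  then have l: "int n ^ ((p - 1) div 2) = \<epsilon> + int p * l" by linarith
  have "p = 1 + 2 * ((p - 1) div 2)"
    using assms(2) by presburger
  then have "r ^ p = r ^ (1 + 2 * ((p - 1) div 2))" by (rule arg_cong)
  also have "\<dots> = r * (r\<^sup>2) ^ ((p - 1) div 2)"
    unfolding power_add power_mult by simp
  also have "(r\<^sup>2) ^ ((p - 1) div 2) = of_int (int n ^ ((p - 1) div 2))"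
    by (simp add: r_squared)
  finally have rp: "r ^ p = r * (of_int \<epsilon> + of_nat p * of_int l)"
    unfolding l by simp
  \<comment> \<open>The collected errors: \<open>l\<close> from Euler's criterion, \<open>h\<close>
    from the binomial expansion, \<open>g1\<close> and \<open>g2\<close> from Frobenius.\<close>
  define w where "w = r * of_int l * \<zeta> ^ p * d ^ p - h - g1 + r * of_int \<epsilon> * \<zeta> ^ p * g2"
  have algw: "algebraic_int w"
    unfolding w_def
    by (intro algebraic_int_plus_complex algebraic_int_minus_complex algebraic_int_times_complex
        algebraic_int_power_complex algebraic_int_r algz algcd h(1) g1(1) g2(1)
        int_imp_algebraic_int Ints_of_int)
  have Gw: "poly G \<xi> = of_nat p * w"
    unfolding poly_G \<xi>2 g1(2) g2(2) h0 rp by (simp add: \<xi>_def w_def algebra_simps)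
  let ?U = "{z::complex. z ^ (4 * n) = 1}"
  let ?q = "\<Prod>\<eta>\<in>(?U - {\<xi>}) - R. \<xi> - \<eta>"
  have finU: "finite ?U" using n_gt_1 by (intro finite_roots_unity) auto
  \<comment> \<open>As \<open>\<xi>\<close> lies outside \<open>R\<close>, the product over all
    other roots of unity contains every factor of \<open>poly G \<xi>\<close>.\<close>
  have "of_nat (4 * n) * \<xi> ^ (4 * n - 1) = (\<Prod>\<eta>\<in>?U - {\<xi>}. \<xi> - \<eta>)"
    using prod_diff_roots_unity[OF \<xi>N] n_gt_1 by simp
  also have "\<dots> = ?q * poly G \<xi>"
    unfolding poly_G_eq_prod using finU R_subset nR by (intro prod.subset_diff) auto
  finally have eq: "of_nat (4 * n) * \<xi> ^ (4 * n - 1) = of_nat p * (?q * w)"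
    by (simp add: Gw mult_ac)
  have "0 < 4 * n" using n_gt_1 by simp
  from power_minus_mult[OF this, of \<xi>] have "\<xi> ^ (4 * n - 1) * \<xi> = 1"
    by (simp only: \<xi>N)
  then have "of_nat (4 * n) = (of_nat (4 * n) * \<xi> ^ (4 * n - 1)) * \<xi>"
    by (simp only: mult.assoc mult_1_right)
  then have "of_int (int (4 * n)) = of_int (int p) * (?q * w * \<xi>)"
    by (simp only: eq mult.assoc of_int_of_nat_eq)
  moreover have "algebraic_int (?q * w * \<xi>)"
    using algw algebraic_int_root_unity[OF _ M0] \<xi>N
    by (intro algebraic_int_times_complex algebraic_int_prod_complex algebraic_int_minus_complex) auto
  ultimately have "int p dvd int (4 * n)"
    using prime_gt_0_nat[OF assms(1)] by (intro int_dvd_if_algebraic_int) auto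
  then have "p dvd 4 * n" by (simp only: int_dvd_int_iff)
  then have "is_unit p"
    using coprime_odd_prime_4_mult[OF assms(1-3)] coprime_absorb_left by blast
  with assms(1) show False by (simp add: not_prime_unit)
qed

text \<open>The map of \<open>R_frobenius\<close> is injective on the finite set \<open>R\<close>,
  hence permutes it; for odd \<open>k\<close> the sign passes unchanged through the k-th
  power.\<close>

lemma P_prime_mult:
  assumes "prime p" "odd p" "\<not> p dvd n" "odd k"
  shows "P (p * k) = of_int (Legendre (int n) (int p)) * P k"
proof -
  define \<epsilon> where "\<epsilon> = complex_of_int (Legendre (int n) (int p))"
  have "\<epsilon> = 1 \<or> \<epsilon> = - 1"
    using assms(3) by (auto simp: \<epsilon>_def Legendre_def cong_0_iff)
  then have eps: "\<epsilon> ^ k = \<epsilon>" "\<epsilon> * \<epsilon> = 1" using assms(4) by auto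
  have "\<epsilon> \<noteq> 0" using eps(2) by auto
  have "inj_on (\<lambda>z. \<epsilon> * z ^ p) R"
  proof (rule inj_onI)
    fix a b assume ab: "a \<in> R" "b \<in> R" "\<epsilon> * a ^ p = \<epsilon> * b ^ p"
    then have "a ^ p = b ^ p" using \<open>\<epsilon> \<noteq> 0\<close> by simp
    moreover have "a ^ (4 * n) = 1" "b ^ (4 * n) = 1" using ab(1,2) R_subset by blast+
    ultimately show "a = b"
      using eq_if_coprime_powers_eq coprime_odd_prime_4_mult[OF assms(1-3)] by blast
  qed
  moreover have "(\<lambda>z. \<epsilon> * z ^ p) ` R \<subseteq> R"
    using R_frobenius[OF assms(1-3)] by (auto simp: \<epsilon>_def)
  ultimately have "bij_betw (\<lambda>z. \<epsilon> * z ^ p) R R"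
    by (simp add: bij_betw_def endo_inj_surj finite_R)
  then have "P k = (\<Sum>z\<in>R. (\<epsilon> * z ^ p) ^ k)"
    unfolding P_def by (rule sum.reindex_bij_betw[symmetric])
  also have "\<dots> = \<epsilon> * P (p * k)"
    unfolding P_def sum_distrib_left by (simp add: power_mult_distrib eps(1) power_mult)
  finally have "\<epsilon> * P k = (\<epsilon> * \<epsilon>) * P (p * k)" by (simp add: mult.assoc)
  then have "P (p * k) = \<epsilon> * P k" using eps(2) by simp
  then show ?thesis by (simp only: \<epsilon>_def)
qed

end

subsection \<open>Power sums of the roots\<close>

text \<open>The factors \<open>[:1, - z:]\<close> build the signs into \<open>e\<close> and make it
  vanish beyond \<open>card R\<close>, so one formula covers every \<open>k\<close>. The proof
  adjoins the roots one at a time.\<close>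

lemma newton_identity:
  fixes R :: "'a :: idom set"
  assumes "finite R"
  defines "e \<equiv> coeff (\<Prod>z\<in>R. [:1, - z:])"
  shows "(\<Sum>i<k. e i * (\<Sum>z\<in>R. z ^ (k - i))) = - of_nat k * e k"
  using assms(1) unfolding e_def
proof (induction arbitrary: k)
  case empty
  then show ?case by (cases k) auto
next
  case (insert x R)
  let ?E = "\<Prod>z\<in>R. [:1, - z:]"
  let ?e = "coeff ?E"
  let ?e' = "coeff ([:1, - x:] * ?E)"
  let ?p = "\<lambda>k. \<Sum>z\<in>R. z ^ k"
  have e'0: "?e' 0 = ?e 0" and e'Suc: "?e' (Suc i) = ?e (Suc i) - x * ?e i" for i
    by simp_all
  show ?case
  proof (cases k)
    case (Suc m)
    have split: "(\<Sum>i<Suc m. ?e' i * h (Suc m - i)) =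
        (\<Sum>i<Suc m. ?e i * h (Suc m - i)) - x * (\<Sum>i<m. ?e i * h (m - i))" for h :: "nat \<Rightarrow> 'a"
      unfolding sum.lessThan_Suc_shift e'0 e'Suc
      by (simp add: algebra_simps sum_subtractf sum_distrib_left)
    have "(\<Sum>i<Suc m. ?e i * x ^ (Suc m - i)) = x * (\<Sum>i<m. ?e i * x ^ (m - i)) + x * ?e m"
      by (simp add: sum_distrib_left Suc_diff_le mult_ac)
    \<comment> \<open>For powers of the new root \<open>x\<close> the two convolutions telescope to
      their last term.\<close>
    then have pow: "(\<Sum>i<Suc m. ?e' i * x ^ (Suc m - i)) = x * ?e m"
      unfolding split by simp
    have "(\<Sum>i<Suc m. ?e' i * (x ^ (Suc m - i) + ?p (Suc m - i))) =
        (\<Sum>i<Suc m. ?e' i * x ^ (Suc m - i)) + (\<Sum>i<Suc m. ?e' i * ?p (Suc m - i))"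
      by (simp only: distrib_left sum.distrib)
    also have "\<dots> = x * ?e m + (- of_nat (Suc m) * ?e (Suc m) - x * (- of_nat m * ?e m))"
      by (simp only: pow split[of ?p] insert.IH)
    also have "\<dots> = - of_nat (Suc m) * ?e' (Suc m)"
      unfolding e'Suc by (simp add: algebra_simps)
    finally show ?thesis
      using insert.hyps by (simp add: Suc del: mult_pCons_left sum.lessThan_Suc)
  qed simp
qed

text \<open>Iterated Frobenius: congruent polynomials have congruent p-th powers, since a - b
  divides a^p - b^p.\<close>

lemma poly_power_prime_power_cong:
  fixes f :: "int poly"
  assumes "prime p"
  shows "of_nat p dvd f ^ (p ^ e) - pcompose f (monom 1 (p ^ e))"
proof (induction e)
  case 0
  have "pcompose f (monom 1 1) = f"
    by (simp add: monom_altdef pcompose_idR)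
  then show ?case by simp
next
  case (Suc e)
  let ?g = "pcompose f (monom 1 (p ^ e))"
  have "f ^ (p ^ e) - ?g dvd (f ^ (p ^ e)) ^ p - ?g ^ p"
    unfolding power_diff_sumr2 by simp
  with Suc have "of_nat p dvd (f ^ (p ^ e)) ^ p - ?g ^ p" by (rule dvd_trans)
  moreover have "of_nat p dvd ?g ^ p - pcompose ?g (monom 1 p)"
    using poly_power_prime_cong[OF assms, of ?g] by auto
  ultimately have "of_nat p dvd ((f ^ (p ^ e)) ^ p - ?g ^ p) + (?g ^ p - pcompose ?g (monom 1 p))"
    by (rule dvd_add)
  moreover have "pcompose ?g (monom 1 p) = pcompose f (monom 1 (p ^ Suc e))"
  proof -
    have "pcompose (monom 1 (p ^ e)) (monom 1 p :: int poly) = monom 1 p ^ (p ^ e)"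
      by (simp add: monom_altdef pcompose_hom.hom_power pcompose_pCons pcompose_smult)
    also have "\<dots> = monom 1 (p ^ Suc e)" by (simp add: monom_power)
    finally show ?thesis by (metis pcompose_assoc)
  qed
  moreover have "(f ^ (p ^ e)) ^ p = f ^ (p ^ Suc e)"
    by (simp add: mult.commute flip: power_mult)
  ultimately show ?case by simp
qed

lemma sum_roots_unity_in_cyclotomic_ring:
  assumes "M > 0" "finite A" "\<And>i. i \<in> A \<Longrightarrow> h i ^ M = (1 :: complex)"
  shows "\<exists>f. (\<Sum>i\<in>A. h i) = poly (map_poly of_int f) (cis (2 * pi / real M))"
  using assms(2,3)
proof (induction A)
  case empty
  then show ?case by (auto intro: exI[of _ 0])
next
  case (insert x A)
  then obtain f where f: "(\<Sum>i\<in>A. h i) = poly (map_poly of_int f) (cis (2 * pi / real M))" by auto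
  have "h x \<in> (\<lambda>k. cis (2 * pi * real k / real M)) ` {..<M}"
    using Complex.bij_betw_roots_unity[OF assms(1)] insert.prems[of x] by (simp add: bij_betw_def)
  then obtain k where "h x = cis (2 * pi * real k / real M)" by blast
  then have k: "h x = cis (2 * pi / real M) ^ k"
    by (simp add: Complex.DeMoivre mult_ac)
  then have "(\<Sum>i\<in>insert x A. h i) =
      poly (map_poly of_int (monom 1 k + f)) (cis (2 * pi / real M))"
    using insert.hyps f k by (simp add: of_int_poly_hom.hom_add poly_monom)
  then show ?case by blast
qed

lemma jacobi_prime_mult:
  assumes "prime p" "k > 0"
  shows "jacobi a (p * k) = Legendre a (int p) * jacobi a k"
  using assms by (simp add: jacobi_def prime_factorization_mult prime_factorization_prime)

context aurifeuillian_pair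
begin

section \<open>Parity grading and values of the power sums\<close>

text \<open>The grading of \<int>[\<surd>n] by parity; it is multiplicative because the square of
  \<open>r\<close> is the integer \<open>n\<close>.\<close>

definition graded :: "nat \<Rightarrow> complex set" where
  "graded k = range (\<lambda>a. (if even k then 1 else r) * of_int a)"

lemma graded_I: "x = (if even k then 1 else r) * of_int a \<Longrightarrow> x \<in> graded k"
  by (auto simp: graded_def)

lemma graded_E:
  assumes "x \<in> graded k"
  obtains a where "x = (if even k then 1 else r) * of_int a"
  using assms by (auto simp only: graded_def)

lemma graded_0: "0 \<in> graded k"
  by (rule graded_I[of _ _ 0]) simp

lemma graded_uminus:
  assumes "x \<in> graded k"
  shows "- x \<in> graded k"
proof -
  obtain a where "x = (if even k then 1 else r) * of_int a" using assms by (rule graded_E)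
  then show ?thesis by (intro graded_I[of _ _ "- a"]) simp
qed

lemma graded_plus:
  assumes "x \<in> graded k" "y \<in> graded k"
  shows "x + y \<in> graded k"
proof -
  obtain a where "x = (if even k then 1 else r) * of_int a" using assms(1) by (rule graded_E)
  moreover obtain b where "y = (if even k then 1 else r) * of_int b" using assms(2) by (rule graded_E)
  ultimately show ?thesis by (intro graded_I[of _ _ "a + b"]) (simp add: distrib_left)
qed

lemma graded_sum: "(\<And>i. i \<in> A \<Longrightarrow> f i \<in> graded k) \<Longrightarrow> sum f A \<in> graded k"
  by (induction A rule: infinite_finite_induct) (auto intro: graded_0 graded_plus)

lemma graded_times:
  assumes "x \<in> graded i" "y \<in> graded j"
  shows "x * y \<in> graded (i + j)"
proof -
  obtain a where a: "x = (if even i then 1 else r) * of_int a" using assms(1) by (rule graded_E)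
  obtain b where b: "y = (if even j then 1 else r) * of_int b" using assms(2) by (rule graded_E)
  have "x * y = (if odd i \<and> odd j then r\<^sup>2 else if odd i \<or> odd j then r else 1) * of_int (a * b)"
  proof -
    have "(u * of_int a) * (v * of_int b) = (u * v) * of_int (a * b)" for u v :: complex
      by (simp add: mult_ac)
    moreover have "(if even i then 1 else r) * (if even j then 1 else r) =
        (if odd i \<and> odd j then r\<^sup>2 else if odd i \<or> odd j then r else 1)"
      by (cases "even i"; cases "even j") (simp_all add: power2_eq_square)
    ultimately show ?thesis by (simp only: a b)
  qed
  also have "\<dots> = (if even (i + j) then 1 else r) *
      of_int ((if odd i \<and> odd j then int n else 1) * (a * b))"
    unfolding r_squared by simp
  finally show ?thesis by (rule graded_I)
qed

lemma graded_of_nat_mult: "x \<in> graded k \<Longrightarrow> of_nat c * x \<in> graded k"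
  using graded_times[of "of_nat c" 0 x k] graded_I[of "of_nat c" 0 "int c"] by simp

abbreviation e :: "nat \<Rightarrow> complex" where "e \<equiv> coeff (\<Prod>z\<in>R. [:1, - z:])"

text \<open>\<open>[:1, - z:]\<close> is the reflection of \<open>[:- z, 1:]\<close>, so the
  coefficients of G appear in reverse order.\<close>

lemma e_eq: "e i = (if i \<le> 2 * lam then coeff G (2 * lam - i) else 0)"
proof -
  have "(\<Prod>z\<in>R. [:1, - z:]) = reflect_poly G"
    unfolding G_eq_prod reflect_poly_prod
    using R_nonzero by (intro prod.cong) (auto simp: reflect_poly_pCons' monom_altdef)
  then show ?thesis by (simp add: coeff_reflect_poly degree_G)
qed

lemma e_in_graded: "e i \<in> graded i"
proof -
  let ?i = "2 * lam - i"
  have "e i = (if even i then 1 else r) *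
      of_int (if i \<le> 2 * lam then if even i then coeff C (?i div 2) else - coeff D (?i div 2) else 0)"
    by (auto simp: e_eq coeff_G)
  then show ?thesis by (rule graded_I)
qed

lemma e_0: "e 0 = 1"
  using lead_coeff_G by (simp add: e_eq degree_G)

lemma P_recurrence:
  assumes "k > 0"
  shows "P k = - (of_nat k * e k + (\<Sum>i\<in>{0<..<k}. e i * P (k - i)))"
proof -
  have "{..<k} = insert 0 {0<..<k}" using assms by auto
  then have "(\<Sum>i<k. e i * P (k - i)) = P k + (\<Sum>i\<in>{0<..<k}. e i * P (k - i))"
    by (simp add: e_0)
  moreover have "(\<Sum>i<k. e i * P (k - i)) = - of_nat k * e k"
    unfolding P_def by (rule newton_identity[OF finite_R])
  ultimately show ?thesis by (simp add: algebra_simps eq_neg_iff_add_eq_0)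
qed

lemma P_in_graded: "k > 0 \<Longrightarrow> P k \<in> graded k"
proof (induction k rule: less_induct)
  case (less k)
  have "e i * P (k - i) \<in> graded k" if "i \<in> {0<..<k}" for i
    using graded_times[OF e_in_graded[of i] less.IH[of "k - i"]] that by simp
  then show ?case
    unfolding P_recurrence[OF less.prems]
    by (intro graded_uminus graded_plus graded_sum graded_of_nat_mult e_in_graded)
qed

text \<open>The first Newton identity gives \<open>r\<close> times the coefficient of
  \<open>D\<close> at \<open>lam - 1\<close>, which is 1 or 0 because \<open>D\<close> is monic of
  degree below \<open>lam\<close>. The case 0 is excluded later by means of the logarithmic
  series.\<close>

lemma P_1: "P 1 = r \<or> P 1 = 0"
proof -
  have "P 1 = - (of_nat 1 * e 1 + (\<Sum>i\<in>{0<..<1}. e i * P (1 - i)))"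
    by (rule P_recurrence) simp
  also have "{0<..<1} = ({} :: nat set)" by auto
  finally have "P 1 = - e 1" by simp
  also have "e 1 = - r * of_int (coeff D (lam - 1))"
  proof -
    have "(2 * lam - 1) div 2 = lam - 1" "odd (2 * lam - 1)" using lam_pos by auto
    then show ?thesis using lam_pos by (simp add: e_eq coeff_G)
  qed
  finally have "P 1 = r * of_int (coeff D (lam - 1))" by simp
  moreover have "coeff D (lam - 1) = 1 \<or> coeff D (lam - 1) = 0"
  proof (cases "degree D = lam - 1")
    case True
    then show ?thesis using lead_D by simp
  next
    case False
    then show ?thesis using degree_D by (intro disjI2 coeff_eq_0) linarith
  qed
  ultimately show ?thesis by auto
qed

text \<open>Since \<open>p\<close> exactly divides \<open>n\<close> and is unramified in \<open>\<rat>(w)\<close>, no nonzero multiple of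
  \<open>r\<close>, the square root of \<open>n\<close>, lies in \<open>\<int>[w]\<close>: by the Frobenius congruence such a multiple is
  divisible by \<open>p\<close> in \<open>\<int>[w]\<close>, which leads to an infinite descent.\<close>
lemma r_multiple_in_cyclotomic_ring:
  fixes w :: complex
  assumes "prime p" "p dvd n" and M: "coprime p M" "w ^ M = 1" "M > 0"
    and "r * of_int a = poly (map_poly of_int f) w"
  shows "a = 0"
proof -
  obtain n' where n': "n = p * n'" using assms(2) by blast
  have "\<not> p dvd n'"
  proof
    assume "p dvd n'"
    then have "p\<^sup>2 dvd n" unfolding n' power2_eq_square by simp
    then have "is_unit p" using squarefree_n by (simp add: squarefree_def)
    with assms(1) show False by (simp add: not_prime_unit)
  qed
  \<comment> \<open>With this exponent the iterated Frobenius fixes \<open>w\<close>.\<close>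
  have pe: "[p ^ totient M = 1] (mod M)"
    using M(1) by (rule euler_theorem)
  have "M dvd p ^ totient M - 1"
    using pe prime_gt_0_nat[OF assms(1)] by (simp add: cong_altdef_nat)
  then obtain c where "p ^ totient M - 1 = M * c" by blast
  then have c: "p ^ totient M = 1 + M * c"
    using prime_gt_0_nat[OF assms(1)] by (metis One_nat_def Suc_pred plus_1_eq_Suc zero_less_power)
  let ?q = "p ^ totient M"
  have wq: "w ^ ?q = w" unfolding c using M(2) by (simp add: power_mult)
  \<comment> \<open>Needed to split a square off the power of f(w) and so expose the factor n = p
    n'.\<close>
  have q2: "?q \<ge> 2"
  proof -
    have "p ^ 1 \<le> ?q"
      using prime_ge_2_nat[OF assms(1)] M(3) by (intro power_increasing) (auto simp: Suc_leI)
    then show ?thesis using prime_ge_2_nat[OF assms(1)] by simp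
  qed
  have alg: "algebraic_int (poly (map_poly of_int g) w)" for g
    using M(2,3) by (intro algebraic_int_of_int_poly algebraic_int_root_unity)
  have step: "\<exists>b g. a = int p * b \<and> r * of_int b = poly (map_poly of_int g) w"
    if a: "r * of_int a = poly (map_poly of_int f) w" for a f
  proof -
    obtain h where "f ^ ?q - pcompose f (monom 1 ?q) = of_nat p * h"
      using poly_power_prime_power_cong[OF assms(1)] by blast
    then have "f ^ ?q = pcompose f (monom 1 ?q) + [:int p:] * h"
      by (simp only: of_nat_poly of_nat_id diff_eq_eq add.commute)
    then have "poly (map_poly of_int (f ^ ?q)) w =
        poly (map_poly of_int (pcompose f (monom 1 ?q) + [:int p:] * h)) w" by simp
    then have h: "poly (map_poly of_int f) w ^ ?q =
        poly (map_poly of_int f) w + of_nat p * poly (map_poly of_int h) w"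
      by (simp add: of_int_poly_hom.hom_power of_int_poly_hom.hom_add of_int_poly_hom.hom_mult
          of_int_hom.map_poly_pcompose poly_pcompose poly_monom wq
          of_int_hom.map_poly_pCons_hom of_int_hom.map_poly_hom_smult)
    \<comment> \<open>From f(w)^q = f(w) + p h(w) and f(w)^2 = p n' a^2 it follows that f(w) = p
      g(w).\<close>
    define g where "g = [:int n' * a\<^sup>2:] * f ^ (?q - 2) - h"
    have "poly (map_poly of_int f) w ^ ?q =
        poly (map_poly of_int f) w ^ 2 * poly (map_poly of_int f) w ^ (?q - 2)"
      using q2 unfolding power_add[symmetric] by (intro arg_cong2[of _ _ _ _ power]) auto
    also have "poly (map_poly of_int f) w ^ 2 = of_nat p * (of_nat n' * (of_int a)\<^sup>2)"
      unfolding a[symmetric] power_mult_distrib r_squared by (simp add: n')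
    finally have fp: "poly (map_poly of_int f) w = of_nat p * poly (map_poly of_int g) w"
      unfolding h g_def
      by (simp add: of_int_poly_hom.hom_power of_int_poly_hom.hom_minus of_int_poly_hom.hom_mult
          of_int_hom.map_poly_pCons_hom of_int_hom.map_poly_hom_smult algebra_simps)
    have "of_int (int n * a\<^sup>2) = (r * of_int a)\<^sup>2"
      by (simp add: power_mult_distrib r_squared)
    also have "\<dots> = of_int (int (p\<^sup>2)) * (poly (map_poly of_int g) w)\<^sup>2"
      unfolding a fp by (simp add: power_mult_distrib)
    \<comment> \<open>Squaring has removed \<open>r\<close>, so divisibility descends to \<int>; as
      \<open>p\<close> divides \<open>n\<close> only once, it must divide \<open>a\<close>.\<close>
    finally have "int (p\<^sup>2) dvd int n * a\<^sup>2"
      using prime_gt_0_nat[OF assms(1)]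
      by (intro int_dvd_if_algebraic_int[OF algebraic_int_power_complex[OF alg]]) auto
    then have "int p * int p dvd int p * (int n' * a\<^sup>2)"
      by (simp add: n' power2_eq_square mult_ac)
    then have "int p dvd int n' * a\<^sup>2"
      using prime_gt_0_nat[OF assms(1)] by simp
    then have "int p dvd a"
      using assms(1) \<open>\<not> p dvd n'\<close> by (auto simp: prime_dvd_mult_iff prime_dvd_power_iff)
    then obtain b where b: "a = int p * b" by blast
    have "of_nat p * (r * of_int b) = of_nat p * poly (map_poly of_int g) w"
      using a fp unfolding b by (simp add: mult_ac)
    then show ?thesis using b prime_gt_0_nat[OF assms(1)] by auto
  qed
  have "int p ^ k dvd a" if "r * of_int a = poly (map_poly of_int f) w" for k a f
    using that
  proof (induction k arbitrary: a f)
    case (Suc k)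
    then obtain b g where "a = int p * b" "r * of_int b = poly (map_poly of_int g) w"
      using step by blast
    then show ?case using Suc.IH by simp
  qed simp
  then have dvd: "int p ^ k dvd a" for k using assms(6) by blast
  show ?thesis
  proof (rule ccontr)
    assume "a \<noteq> 0"
    from dvd_imp_le_int[OF this dvd[of "nat \<bar>a\<bar>"]] have "int p ^ nat \<bar>a\<bar> \<le> \<bar>a\<bar>" by simp
    moreover have "nat \<bar>a\<bar> < p ^ nat \<bar>a\<bar>"
      using prime_gt_1_nat[OF assms(1)] by (intro power_gt_expt) auto
    then have "int (nat \<bar>a\<bar>) < int (p ^ nat \<bar>a\<bar>)" by (simp only: of_nat_less_iff)
    ultimately show False by simp
  qed
qed

text \<open>As \<open>p\<close> divides \<open>k\<close>, the k-th powers of the roots have order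
  dividing 4n/p, which is prime to \<open>p\<close>; as \<open>k\<close> is odd, their sum is also a
  multiple of \<open>r\<close>. Only 0 satisfies both.\<close>

lemma P_eq_0:
  assumes "prime p" "odd p" "p dvd n" "odd k" "p dvd k"
  shows "P k = 0"
proof -
  obtain n' where n': "n = p * n'" using assms(3) by blast
  obtain k' where k': "k = p * k'" using assms(5) by blast
  have M0: "4 * n' > 0" using n' n_gt_1 by (auto intro: Nat.gr0I)
  have "\<not> p dvd n'"
  proof
    assume "p dvd n'"
    then have "p\<^sup>2 dvd n" unfolding n' power2_eq_square by simp
    then have "is_unit p" using squarefree_n by (simp add: squarefree_def)
    with assms(1) show False by (simp add: not_prime_unit)
  qed
  then have cop: "coprime p (4 * n')"
    using coprime_odd_prime_4_mult assms(1,2) by blast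
  have "(z ^ k) ^ (4 * n') = 1" if "z \<in> R" for z
  proof -
    have "(z ^ k) ^ (4 * n') = (z ^ (4 * n)) ^ k'"
      by (simp add: n' k' mult_ac flip: power_mult)
    also have "z ^ (4 * n) = 1" using that R_subset by blast
    finally show ?thesis by simp
  qed
  then obtain f where f: "P k = poly (map_poly of_int f) (cis (2 * pi / real (4 * n')))"
    using sum_roots_unity_in_cyclotomic_ring[OF M0 finite_R, of "\<lambda>z. z ^ k"] unfolding P_def by blast
  have "k > 0" using assms(4) odd_pos by blast
  then obtain a where "P k = (if even k then 1 else r) * of_int a"
    using P_in_graded graded_E by blast
  then have a: "P k = r * of_int a" using assms(4) by simp
  have "cis (2 * pi / real M) ^ M = 1" if "M > 0" for M
    using that by (simp add: Complex.DeMoivre)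
  from this[OF M0] have "cis (2 * pi / real (4 * n')) ^ (4 * n') = 1" .
  then have "a = 0"
    using r_multiple_in_cyclotomic_ring[OF assms(1,3) cop _ M0] f a by metis
  with a show ?thesis by simp
qed

text \<open>Prime factors of \<open>k\<close> are split off one at a time: a prime dividing
  \<open>n\<close> makes both sides 0, any other contributes its Legendre symbol.\<close>

lemma P_odd: "odd k \<Longrightarrow> P k = of_int (jacobi (int n) k) * P 1"
proof (induction k rule: less_induct)
  case (less k)
  show ?case
  proof (cases "k = 1")
    case True
    then show ?thesis by (simp add: jacobi_def)
  next
    case False
    then obtain p where p: "prime p" "p dvd k" using prime_factor_nat by blast
    then obtain k' where k': "k = p * k'" by blast
    have odd: "odd p" "odd k'" using less.prems k' by auto
    then have "k' > 0" using odd_pos by blast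
    then have "k' < k" using k' prime_gt_1_nat[OF p(1)] by simp
    have jac: "jacobi (int n) k = Legendre (int n) (int p) * jacobi (int n) k'"
      unfolding k' by (rule jacobi_prime_mult[OF p(1) \<open>k' > 0\<close>])
    show ?thesis
    proof (cases "p dvd n")
      case True
      then have "Legendre (int n) (int p) = 0" by (simp add: Legendre_def cong_0_iff)
      then show ?thesis
        using P_eq_0[OF p(1) odd(1) True less.prems p(2)] by (simp add: jac)
    next
      case False
      have "P k = of_int (Legendre (int n) (int p)) * P k'"
        unfolding k' by (rule P_prime_mult[OF p(1) odd(1) False odd(2)])
      also have "P k' = of_int (jacobi (int n) k') * P 1"
        by (rule less.IH[OF \<open>k' < k\<close> odd(2)])
      finally show ?thesis by (simp only: jac of_int_mult mult.assoc)
    qed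
  qed
qed

end

subsection \<open>Rounding\<close>

text \<open>The cube of the claim is e \<le> 3 < 27/8.\<close>

lemma exp_third_less: "exp (1 / 3 :: real) < 3 / 2"
proof -
  have "exp (1 / 3 :: real) ^ 3 = exp 1"
    by (simp flip: exp_of_nat_mult)
  also have "\<dots> < (3 / 2) ^ 3"
    using exp_le by (simp add: power3_eq_cube)
  finally show ?thesis
    by (rule power_less_imp_less_base) simp
qed

lemma abs_exp_minus_1_le: "\<bar>exp x - 1\<bar> \<le> \<bar>x\<bar> * exp \<bar>x\<bar>" for x :: real
proof (cases "x \<ge> 0")
  case True
  have "exp x * (1 - x) \<le> exp x * exp (- x)"
    using exp_ge_add_one_self[of "- x"] by (intro mult_left_mono) auto
  then show ?thesis using True by (simp add: exp_minus algebra_simps)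
next
  case False
  have "1 - exp x \<le> - x" using exp_ge_add_one_self[of x] by linarith
  also have "\<dots> \<le> - x * exp (- x)"
    using False mult_left_mono[of 1 "exp (- x)" "- x"] by simp
  finally show ?thesis using False by (simp add: abs_if)
qed

text \<open>The error is at most a \<epsilon> exp(1/3) < 1/3 * 3/2 = 1/2; the bounds 1/3 are chosen
  for this.\<close>

lemma round_approximation:
  fixes a \<delta> \<epsilon> :: real and k :: int
  assumes "a = of_int k" "a \<ge> 0" "\<bar>\<delta>\<bar> \<le> \<epsilon>" "\<epsilon> \<le> 1 / 3" "a * \<epsilon> \<le> 1 / 3"
  shows "k = \<lfloor>a * exp \<delta> + 1 / 2\<rfloor>"
proof -
  have "a * exp \<delta> - a = a * (exp \<delta> - 1)" by (simp add: algebra_simps)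
  then have "\<bar>a * exp \<delta> - a\<bar> = a * \<bar>exp \<delta> - 1\<bar>"
    using assms(2) by (simp only: abs_mult abs_of_nonneg)
  also have "\<dots> \<le> a * (\<bar>\<delta>\<bar> * exp \<bar>\<delta>\<bar>)"
    using assms(2) abs_exp_minus_1_le by (intro mult_left_mono) auto
  also have "\<dots> \<le> a * (\<epsilon> * exp (1 / 3))"
    using assms by (intro mult_left_mono mult_mono) auto
  also have "\<dots> = (a * \<epsilon>) * exp (1 / 3)" by simp
  also have "\<dots> \<le> 1 / 3 * exp (1 / 3)"
    using assms(5) by (intro mult_right_mono) auto
  also have "\<dots> < 1 / 2" using exp_third_less by simp
  finally have "\<bar>a * exp \<delta> - a\<bar> < 1 / 2" .
  then have "of_int k \<le> a * exp \<delta> + 1 / 2" "a * exp \<delta> + 1 / 2 < of_int k + 1"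
    unfolding assms(1)[symmetric] abs_less_iff by linarith+
  then show ?thesis by (simp add: floor_unique)
qed

lemma abs_jacobi_le: "\<bar>jacobi a k\<bar> \<le> 1"
proof -
  have "\<bar>prod_mset (image_mset (\<lambda>p. Legendre a (int p)) M)\<bar> \<le> 1" for M
  proof (induction M)
    case (add p M)
    have "\<bar>Legendre a (int p)\<bar> \<le> 1" by (simp add: Legendre_def)
    with add mult_mono[of "\<bar>Legendre a (int p)\<bar>" 1] show ?case by (simp add: abs_mult)
  qed simp
  then show ?thesis by (simp add: jacobi_def)
qed

text \<open>Comparison with a geometric series of ratio 1/x, all odd denominators of the tail being
  replaced by the first one, 2l + 1.\<close>

lemma odd_power_series_tail_bound:
  fixes c :: "nat \<Rightarrow> real" and x m s :: real
  assumes "x > 1" "m > 0" and c: "\<And>j. \<bar>c j\<bar> \<le> 1"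
    and sums: "(\<lambda>j. c j / (m * real (2 * j + 1) * x ^ j)) sums s"
  shows "\<bar>s - (\<Sum>j<l. c j / (m * real (2 * j + 1) * x ^ j))\<bar> \<le>
           1 / (m * real (2 * l + 1)) * (1 / x) ^ l * (x / (x - 1))"
proof -
  let ?f = "\<lambda>j. c j / (m * real (2 * j + 1) * x ^ j)"
  let ?K = "1 / (m * real (2 * l + 1)) * (1 / x) ^ l"
  have "(\<lambda>j. ?K * (1 / x) ^ j) sums (?K * (1 / (1 - 1 / x)))"
    using assms(1) by (intro sums_mult geometric_sums) auto
  moreover have "1 / (1 - 1 / x) = x / (x - 1)" using assms(1) by (simp add: field_simps)
  ultimately have g: "(\<lambda>j. ?K * (1 / x) ^ j) sums (?K * (x / (x - 1)))" by simp
  have le: "norm (?f (j + l)) \<le> ?K * (1 / x) ^ j" for j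
  proof -
    have "norm (?f (j + l)) = \<bar>c (j + l)\<bar> / (m * real (2 * (j + l) + 1) * x ^ (j + l))"
      using assms(1,2) by (simp add: abs_mult)
    also have "\<dots> \<le> 1 / (m * real (2 * l + 1) * x ^ (j + l))"
      using assms(1,2) c[of "j + l"] by (intro frac_le mult_mono) auto
    also have "\<dots> = ?K * (1 / x) ^ j"
      by (simp add: power_add power_divide mult_ac)
    finally show ?thesis .
  qed
  have "s - (\<Sum>j<l. ?f j) = (\<Sum>j. ?f (j + l))"
    using sums suminf_split_initial_segment[of ?f l] by (simp add: sums_iff)
  also have "norm \<dots> \<le> (\<Sum>j. ?K * (1 / x) ^ j)"
    using le g by (intro norm_suminf_le) (auto simp: sums_iff)
  finally show ?thesis using g by (simp add: sums_iff)
qed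

subsection \<open>Logarithmic series\<close>

context aurifeuillian_pair
begin

lemma norm_R_div_less: "z \<in> R \<Longrightarrow> y > 1 \<Longrightarrow> norm (z / complex_of_real y) < 1"
  by (simp add: norm_divide norm_R)

text \<open>The roots have norm 1, so the series converges for y > 1. The term at k = 0 is 0 because
  division by zero gives 0.\<close>

lemma Ln_1_minus_sums:
  assumes "y > (1 :: real)"
  shows "(\<lambda>k. - P k / (of_nat k * of_real y ^ k)) sums (\<Sum>z\<in>R. Ln (1 - z / of_real y))"
proof -
  have "(\<lambda>k. \<Sum>z\<in>R. (- 1) ^ Suc k / of_nat k * (- (z / of_real y)) ^ k) sums
      (\<Sum>z\<in>R. Ln (1 + - (z / of_real y)))"
    using norm_R_div_less[OF _ assms] by (intro sums_sum Ln_series) simp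
  moreover have "(\<Sum>z\<in>R. (- 1) ^ Suc k / of_nat k * (- (z / of_real y)) ^ k) =
      - P k / (of_nat k * of_real y ^ k)" for k
  proof -
    have "(- 1) ^ Suc k / of_nat k * (- (z / of_real y)) ^ k =
        - (z ^ k / (of_nat k * of_real y ^ k))" for z :: complex
      by (simp add: power_minus[of "z / of_real y"] power_divide flip: power_mult_distrib)
    then show ?thesis by (simp add: P_def sum_negf sum_divide_distrib)
  qed
  ultimately show ?thesis by simp
qed

lemma Ln_1_plus_sums:
  assumes "y > (1 :: real)"
  shows "(\<lambda>k. - ((- 1) ^ k * P k / (of_nat k * of_real y ^ k))) sums (\<Sum>z\<in>R. Ln (1 + z / of_real y))"
proof -
  have "(\<lambda>k. \<Sum>z\<in>R. (- 1) ^ Suc k / of_nat k * (z / of_real y) ^ k) sums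
      (\<Sum>z\<in>R. Ln (1 + z / of_real y))"
    using norm_R_div_less[OF _ assms] by (intro sums_sum Ln_series)
  moreover have "(\<Sum>z\<in>R. (- 1) ^ Suc k / of_nat k * (z / of_real y) ^ k) =
      - ((- 1) ^ k * P k / (of_nat k * of_real y ^ k))" for k
    by (simp add: P_def power_divide sum_distrib_left sum_divide_distrib sum_negf)
  ultimately show ?thesis by simp
qed

lemma poly_G_eq_exp:
  assumes "y > (1 :: real)"
  shows "poly G (of_real y) = of_real y ^ (2 * lam) * exp (\<Sum>z\<in>R. Ln (1 - z / of_real y))"
    and "poly G (- of_real y) = of_real y ^ (2 * lam) * exp (\<Sum>z\<in>R. Ln (1 + z / of_real y))"
proof -
  have nz: "1 - z / of_real y \<noteq> 0" "1 + z / of_real y \<noteq> 0" if "z \<in> R" for z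
    using norm_R_div_less[OF that assms] by (auto simp: add_eq_0_iff)
  have "poly G (of_real y) = (\<Prod>z\<in>R. of_real y * (1 - z / of_real y))"
    unfolding poly_G_eq_prod using assms by (intro prod.cong) (auto simp: right_diff_distrib)
  also have "\<dots> = of_real y ^ (2 * lam) * exp (\<Sum>z\<in>R. Ln (1 - z / of_real y))"
    using nz by (simp add: prod.distrib card_R exp_sum[OF finite_R])
  finally show "poly G (of_real y) = of_real y ^ (2 * lam) * exp (\<Sum>z\<in>R. Ln (1 - z / of_real y))" .
  have "poly G (- of_real y) = (\<Prod>z\<in>R. - of_real y * (1 + z / of_real y))"
    unfolding poly_G_eq_prod using assms by (intro prod.cong) (auto simp: distrib_left)
  \<comment> \<open>The number of roots is even, so the signs cancel.\<close>
  also have "\<dots> = of_real y ^ (2 * lam) * exp (\<Sum>z\<in>R. Ln (1 + z / of_real y))"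
    using nz by (simp only: prod.distrib prod_constant card_R) (simp add: exp_sum[OF finite_R])
  finally show "poly G (- of_real y) = of_real y ^ (2 * lam) * exp (\<Sum>z\<in>R. Ln (1 + z / of_real y))" .
qed

text \<open>In the difference of the two logarithmic series the even exponents cancel and the odd
  ones double.\<close>

lemma odd_series_sums:
  assumes "y > (1 :: real)"
  shows "(\<lambda>j. - 2 * P (2 * j + 1) / (of_nat (2 * j + 1) * of_real y ^ (2 * j + 1))) sums
    ((\<Sum>z\<in>R. Ln (1 - z / of_real y)) - (\<Sum>z\<in>R. Ln (1 + z / of_real y)))"
proof -
  let ?f = "\<lambda>k. - P k / (of_nat k * of_real y ^ k) - - ((- 1) ^ k * P k / (of_nat k * of_real y ^ k))"
  have "?f sums ((\<Sum>z\<in>R. Ln (1 - z / of_real y)) - (\<Sum>z\<in>R. Ln (1 + z / of_real y)))"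
    by (intro sums_diff Ln_1_minus_sums Ln_1_plus_sums assms)
  moreover have "?f k = 0" if "k \<notin> range (\<lambda>j. 2 * j + 1)" for k
  proof -
    have "even k" by (rule ccontr) (use that in \<open>auto elim!: oddE\<close>)
    then show ?thesis by simp
  qed
  moreover have "strict_mono (\<lambda>j::nat. 2 * j + 1)" by (simp add: strict_mono_def)
  ultimately have "(\<lambda>j. ?f (2 * j + 1)) sums
      ((\<Sum>z\<in>R. Ln (1 - z / of_real y)) - (\<Sum>z\<in>R. Ln (1 + z / of_real y)))"
    by (subst sums_mono_reindex) auto
  moreover have "?f (2 * j + 1) = - 2 * P (2 * j + 1) / (of_nat (2 * j + 1) * of_real y ^ (2 * j + 1))" for j
    by simp
  ultimately show ?thesis by (simp only:)
qed

text \<open>Otherwise all odd power sums vanish, G(y) = G(-y) for all y > 1, and \<open>D\<close>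
  has infinitely many zeros although it is monic.\<close>

lemma P_1_eq_r: "P 1 = r"
proof (rule ccontr)
  assume "P 1 \<noteq> r"
  then have P0: "P (2 * j + 1) = 0" for j
    using P_1 P_odd[of "2 * j + 1"] by simp
  have D0: "poly (map_poly complex_of_int D) (of_real t) = 0" if "t > 1" for t :: real
  proof -
    let ?y = "sqrt t"
    have y: "?y > 1" using that by simp
    have "(\<lambda>j. 0) sums ((\<Sum>z\<in>R. Ln (1 - z / of_real ?y)) - (\<Sum>z\<in>R. Ln (1 + z / of_real ?y)))"
      using odd_series_sums[OF y] by (simp only: P0) simp
    from sums_unique2[OF this sums_zero]
    have "(\<Sum>z\<in>R. Ln (1 - z / of_real ?y)) = (\<Sum>z\<in>R. Ln (1 + z / of_real ?y))"
      by (simp only: right_minus_eq)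
    then have "poly G (of_real ?y) = poly G (- of_real ?y)"
      using poly_G_eq_exp[OF y] by simp
    then have "r * of_real ?y * poly (map_poly of_int D) ((of_real ?y)\<^sup>2) = 0"
      by (simp add: poly_G)
    moreover have "(complex_of_real ?y)\<^sup>2 = of_real t"
      using that by (simp flip: of_real_power)
    moreover have "r \<noteq> 0" using n_gt_1 by (simp add: r_def)
    ultimately show ?thesis using that by simp
  qed
  have "map_poly complex_of_int D \<noteq> 0"
    using lead_D by auto
  then have "finite {z. poly (map_poly complex_of_int D) z = 0}" by (rule poly_roots_finite)
  moreover have "complex_of_real ` {1<..} \<subseteq> {z. poly (map_poly complex_of_int D) z = 0}"
    using D0 by auto
  ultimately have "finite (complex_of_real ` {1<..})" by (rule finite_subset[rotated])
  then have "finite {1::real<..}" by (rule finite_imageD) (simp add: inj_on_def)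
  then show False using infinite_Ioi by blast
qed

end

section \<open>The integer factors at x = m^2 n and the truncation error\<close>

locale aurifeuillian_factor = aurifeuillian_pair +
  fixes m x :: nat
  assumes m_pos: "m > 0" and x_eq: "x = m\<^sup>2 * n"
begin

definition y :: real where "y = real m * sqrt (real n)"

definition Fminus :: int where "Fminus = poly C (int x) - int (m * n) * poly D (int x)"

definition Fplus :: int where "Fplus = poly C (int x) + int (m * n) * poly D (int x)"

lemma y_squared: "y\<^sup>2 = real x"
  by (simp add: y_def x_eq power_mult_distrib)

lemma x_ge: "x \<ge> m * n" "x \<ge> 2"
proof -
  have "m * n * 1 \<le> m * n * m" using m_pos by (intro mult_left_mono) auto
  then show "x \<ge> m * n" by (simp add: x_eq power2_eq_square mult_ac)
  moreover have "1 * 2 \<le> m * n" using m_pos n_gt_1 by (intro mult_mono) auto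
  ultimately show "x \<ge> 2" by simp
qed

lemma y_gt_1: "y > 1"
proof (rule power2_less_imp_less)
  show "1\<^sup>2 < y\<^sup>2" using x_ge(2) unfolding y_squared by simp
qed (simp add: y_def)

lemma r_mult_y: "r * of_real y = of_nat (m * n)"
proof -
  have "r * of_real y = of_real (sqrt (real n) * y)"
    by (simp add: r_def)
  also have "sqrt (real n) * y = real (m * n)" by (simp add: y_def)
  finally show ?thesis by simp
qed

lemma poly_of_int_x: "poly (map_poly of_int p) ((complex_of_real y)\<^sup>2) = of_int (poly p (int x))"
proof -
  have "(complex_of_real y)\<^sup>2 = of_int (int x)"
    using y_squared by (simp flip: of_real_power)
  then show ?thesis by (simp only: of_int_hom.poly_map_poly)
qed

lemma poly_G_y: "poly G (of_real y) = of_int Fminus" "poly G (- of_real y) = of_int Fplus"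
  unfolding poly_G power2_minus poly_of_int_x by (simp_all add: r_mult_y Fminus_def Fplus_def)

lemma Fminus_mult_Fplus: "Fminus * Fplus = poly (aurif_F n) (int x)"
proof -
  have "complex_of_int (Fminus * Fplus) = of_int (poly (aurif_F n) (int x))"
    using poly_G_mult_poly_G_minus[of "of_real y"] by (simp add: poly_G_y poly_of_int_x)
  then show ?thesis by (simp only: of_int_eq_iff)
qed

lemma P_real: "Im (P k / (of_nat k * of_real y ^ k)) = 0"
proof (cases "k = 0")
  case False
  then obtain a where "P k = (if even k then 1 else r) * of_int a"
    using P_in_graded graded_E by blast
  then have "P k / (of_nat k * of_real y ^ k) =
      of_real ((if even k then 1 else sqrt (real n)) * of_int a / (real k * y ^ k))"
    by (simp add: r_def)
  then show ?thesis by (simp only: Im_complex_of_real)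
qed simp

text \<open>All terms of the logarithmic series are real, so the value of G at \<open>y\<close> is a
  positive real times a real exponential.\<close>

lemma Fminus_pos: "Fminus > 0"
proof -
  let ?L = "\<Sum>z\<in>R. Ln (1 - z / of_real y)"
  have "Im (- P k / (of_nat k * of_real y ^ k)) = 0" for k
    using P_real[of k] by (simp only: minus_divide_left[symmetric] uminus_complex.sel neg_equal_0_iff_equal)
  then have "(\<lambda>k. 0) sums Im ?L"
    using sums_Im[OF Ln_1_minus_sums[OF y_gt_1]] by (simp only:)
  then have "Im ?L = 0" using sums_zero by (rule sums_unique2)
  then have "?L = of_real (Re ?L)" by (simp add: complex_eq_iff)
  then have "exp ?L = of_real (exp (Re ?L))" by (metis exp_of_real)
  then have "complex_of_int Fminus = of_real (y ^ (2 * lam) * exp (Re ?L))"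
    using poly_G_eq_exp(1)[OF y_gt_1] by (simp add: poly_G_y)
  then have "real_of_int Fminus = y ^ (2 * lam) * exp (Re ?L)"
    by (metis of_real_eq_iff of_real_of_int_eq)
  then have "real_of_int Fminus > 0" using y_gt_1 by simp
  then show ?thesis by simp
qed

lemma two_lam_le: "2 * lam \<le> m * n"
proof -
  have "totient (2 * n) \<le> n"
  proof (cases "even n")
    case True
    then obtain k where k: "n = 2 * k" "odd k" using squarefree_even_nat squarefree_n by blast
    then show ?thesis
      using totient_double[of "2 * k"] totient_double[of k] by (simp add: totient_le)
  next
    case False
    then show ?thesis using totient_double[of n] by (simp add: totient_le)
  qed
  also have "n \<le> m * n" using m_pos by simp
  finally show ?thesis by (simp add: two_lam)
qed

text \<open>The linear coefficient of \<open>G\<close> makes the mean of \<open>|y - z|\<^sup>2\<close> over the roots at most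
  \<open>x - 1\<close>; the bound then follows from the inequality between the arithmetic and geometric
  means, here in the form \<open>t \<le> exp (t - 1)\<close>.\<close>
lemma Fminus_le: "real_of_int Fminus \<le> (real x - 1) ^ lam"
proof (rule power2_le_imp_le)
  have x1: "real x - 1 > 0" using x_ge by simp
  let ?t = "\<lambda>z. (norm (of_real y - z))\<^sup>2 / (real x - 1)"
  have norm_sq: "(norm (of_real y - z))\<^sup>2 = real x + 1 - 2 * y * Re z" if "z \<in> R" for z
  proof -
    have "(Re z)\<^sup>2 + (Im z)\<^sup>2 = 1" using norm_R[OF that] by (metis cmod_power2 one_power2)
    then show ?thesis
      by (simp add: cmod_power2 power2_diff y_squared[symmetric])
  qed
  have "(\<Sum>z\<in>R. (norm (of_real y - z))\<^sup>2) = (\<Sum>z\<in>R. real x + 1 - 2 * y * Re z)"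
    using norm_sq by (intro sum.cong) auto
  also have "\<dots> = 2 * real lam * (real x + 1) - 2 * y * Re (P 1)"
    by (simp add: sum_subtractf card_R P_def flip: sum_distrib_left)
  \<comment> \<open>With \<open>two_lam_le\<close> this lowers the mean from x + 1 to at most x -
    1.\<close>
  also have "y * Re (P 1) = real (m * n)"
    by (simp add: P_1_eq_r[unfolded One_nat_def] r_def y_def)
  then have "2 * real lam * (real x + 1) - 2 * y * Re (P 1) \<le> 2 * real lam * (real x - 1)"
    using two_lam_le by (simp add: algebra_simps flip: of_nat_mult)
  finally have sum_le: "(\<Sum>z\<in>R. (norm (of_real y - z))\<^sup>2) \<le> 2 * real lam * (real x - 1)" .
  have "(\<Prod>z\<in>R. ?t z) \<le> (\<Prod>z\<in>R. exp (?t z - 1))"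
    using x1 exp_ge_add_one_self[of "?t z - 1" for z] by (intro prod_mono) auto
  also have "\<dots> = exp ((\<Sum>z\<in>R. ?t z) - 2 * real lam)"
    by (simp add: exp_sum[OF finite_R, symmetric] sum_subtractf card_R)
  also have "\<dots> \<le> 1"
    using sum_le x1 by (simp add: divide_le_eq flip: sum_divide_distrib)
  finally have "(\<Prod>z\<in>R. (norm (of_real y - z))\<^sup>2) / (real x - 1) ^ (2 * lam) \<le> 1"
    by (simp add: prod_dividef card_R)
  then have le: "(\<Prod>z\<in>R. (norm (of_real y - z))\<^sup>2) \<le> (real x - 1) ^ (2 * lam)"
    using x1 by (simp add: divide_le_eq)
  have "(real_of_int Fminus)\<^sup>2 = (norm (poly G (of_real y)))\<^sup>2"
    by (simp add: poly_G_y)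
  also have "\<dots> = (\<Prod>z\<in>R. (norm (of_real y - z))\<^sup>2)"
    by (simp add: poly_G_eq_prod prod_norm[symmetric] prod_power_distrib)
  also note le
  finally show "(real_of_int Fminus)\<^sup>2 \<le> ((real x - 1) ^ lam)\<^sup>2"
    by (simp add: power_mult mult.commute flip: power_mult)
qed (use x_ge in simp)

text \<open>In the quotient G(y) / G(-y) the powers of \<open>y\<close> cancel, and the \<surd>n in
  the odd power sums cancels against the one in y^(2j+1) = x^j m \<surd>n.\<close>

lemma Fminus_eq_exp:
  obtains s where
    "(\<lambda>j. real_of_int (jacobi (int n) (2 * j + 1)) / (real m * real (2 * j + 1) * real x ^ j)) sums s"
    "real_of_int Fminus = real_of_int Fplus * exp (- 2 * s)"
proof -
  define S where "S = (\<Sum>z\<in>R. Ln (1 - z / of_real y)) - (\<Sum>z\<in>R. Ln (1 + z / of_real y))"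
  let ?t = "\<lambda>j. real_of_int (jacobi (int n) (2 * j + 1)) / (real m * real (2 * j + 1) * real x ^ j)"
  have summand: "- 2 * P (2 * j + 1) / (of_nat (2 * j + 1) * of_real y ^ (2 * j + 1)) =
      of_real (- 2 * ?t j)" for j
  proof -
    have "y ^ (2 * j + 1) = real x ^ j * (real m * sqrt (real n))"
      by (simp add: power_mult y_squared) (simp add: y_def)
    moreover have "P (2 * j + 1) = of_real (real_of_int (jacobi (int n) (2 * j + 1)) * sqrt (real n))"
      using P_odd[of "2 * j + 1"] by (simp add: P_1_eq_r[unfolded One_nat_def] r_def)
    ultimately have "- 2 * P (2 * j + 1) / (of_nat (2 * j + 1) * of_real y ^ (2 * j + 1)) =
        of_real (- 2 * (real_of_int (jacobi (int n) (2 * j + 1)) * sqrt (real n)) /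
          (real (2 * j + 1) * (real x ^ j * (real m * sqrt (real n)))))"
      by (simp flip: of_real_power del: power_Suc)
    also have "- 2 * (real_of_int (jacobi (int n) (2 * j + 1)) * sqrt (real n)) /
          (real (2 * j + 1) * (real x ^ j * (real m * sqrt (real n)))) = - 2 * ?t j"
    proof -
      have "- 2 * (a * q) / (b * (c * (d * q))) = - 2 * (a / (d * b * c))" if "q \<noteq> 0"
        for a b c d q :: real
      proof -
        have "b * (c * (d * q)) = (d * b * c) * q" by (simp add: mult_ac)
        then show ?thesis using that by simp
      qed
      then show ?thesis using n_gt_1 by simp
    qed
    finally show ?thesis .
  qed
  have sums: "(\<lambda>j. complex_of_real (- 2 * ?t j)) sums S"
    using odd_series_sums[OF y_gt_1] unfolding summand S_def .
  from sums_Re[OF this] have re: "(\<lambda>j. - 2 * ?t j) sums Re S"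
    unfolding Re_complex_of_real .
  then have "(\<lambda>j. complex_of_real (- 2 * ?t j)) sums of_real (Re S)" by (rule sums_of_real)
  \<comment> \<open>A limit of real partial sums is real, so the identity can be read over the
    reals.\<close>
  then have S: "S = of_real (Re S)" using sums sums_unique2 by blast
  show ?thesis
  proof (rule that)
    show "?t sums (- (1 / 2) * Re S)"
      using sums_mult[OF re, of "- (1 / 2)"] by simp
    have "complex_of_int Fminus = of_int Fplus * exp S"
      using poly_G_eq_exp[OF y_gt_1] by (simp add: poly_G_y exp_diff S_def)
    also have "exp S = of_real (exp (Re S))" using S by (metis exp_of_real)
    finally have "complex_of_real (real_of_int Fminus) = of_real (real_of_int Fplus * exp (Re S))"
      by simp
    then have "real_of_int Fminus = real_of_int Fplus * exp (Re S)" by (simp only: of_real_eq_iff)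
    then show "real_of_int Fminus = real_of_int Fplus * exp (- 2 * (- (1 / 2) * Re S))" by simp
  qed
qed

text \<open>By \<open>Fminus_eq_exp\<close>, F is the square of \<open>Fminus\<close> times exp(s),
  so truncating the series multiplies \<open>Fminus\<close> by the exponential of the tail. The tail
  bound and \<open>Fminus_le\<close> make the error less than 1/2.\<close>

lemma Fminus_eq_floor:
  "Fminus = \<lfloor>sqrt (real_of_int (poly (aurif_F n) (int x))) *
     exp (- (1 / real m) *
       (\<Sum>j<lam. real_of_int (jacobi (int n) (2 * j + 1)) / (real (2 * j + 1) * real x ^ j))) + 1 / 2\<rfloor>"
proof -
  let ?a = "real_of_int Fminus"
  let ?j = "\<lambda>j. real_of_int (jacobi (int n) (2 * j + 1))"
  let ?t = "\<lambda>j. ?j j / (real m * real (2 * j + 1) * real x ^ j)"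
  obtain s where s: "?t sums s" "?a = real_of_int Fplus * exp (- 2 * s)"
    using Fminus_eq_exp by blast
  have x1: "real x > 1" using x_ge by simp
  have "real_of_int (poly (aurif_F n) (int x)) = ?a * real_of_int Fplus"
    by (simp flip: Fminus_mult_Fplus)
  also have "real_of_int Fplus = ?a * exp (2 * s)"
    using s(2) by (simp add: exp_minus field_simps)
  also have "?a * (?a * exp (2 * s)) = (?a * exp s)\<^sup>2"
    by (simp add: power2_eq_square mult_exp_exp algebra_simps)
  finally have sqrt: "sqrt (real_of_int (poly (aurif_F n) (int x))) = ?a * exp s"
    using Fminus_pos by simp
  have sum: "- (1 / real m) * (\<Sum>j<lam. ?j j / (real (2 * j + 1) * real x ^ j)) = - (\<Sum>j<lam. ?t j)"
    by (simp add: sum_distrib_left sum_negf mult_ac)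
  define \<epsilon> where "\<epsilon> = 1 / (real m * real (2 * lam + 1)) * (1 / real x) ^ lam * (real x / (real x - 1))"
  have "\<bar>s - (\<Sum>j<lam. ?t j)\<bar> \<le> \<epsilon>"
    unfolding \<epsilon>_def using x1 m_pos s(1) abs_jacobi_le
    by (intro odd_power_series_tail_bound) (auto simp flip: of_int_abs)
  \<comment> \<open>The constant 1/3 comes from m \<ge> 1 and 2 lam + 1 \<ge> 3.\<close>
  moreover have K: "1 / (real m * real (2 * lam + 1)) \<le> 1 / 3"
  proof -
    have "1 * 3 \<le> m * (2 * lam + 1)" using m_pos lam_pos by (intro mult_mono) auto
    then have "real (1 * 3) \<le> real (m * (2 * lam + 1))" by (rule of_nat_mono)
    then have "3 \<le> real m * real (2 * lam + 1)"
      by (simp only: of_nat_mult of_nat_1 of_nat_numeral mult_1)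
    then show ?thesis by (intro frac_le) (assumption | simp)+
  qed
  \<comment> \<open>One factor 1/x of the tail cancels the numerator of x/(x - 1), leaving 1/(x - 1)
    to be absorbed by the bound (x - 1)^lam on \<open>Fminus\<close>.\<close>
  obtain l where l: "lam = Suc l" using lam_pos gr0_implies_Suc by blast
  have \<epsilon>: "\<epsilon> = 1 / (real m * real (2 * lam + 1)) * ((1 / real x) ^ l * (1 / (real x - 1)))"
    using x1 by (simp add: \<epsilon>_def l)
  have "(1 / real x) ^ l \<le> 1" "1 / (real x - 1) \<le> 1"
    using x_ge(2) x1 by (auto intro: power_le_one)
  then have "(1 / real x) ^ l * (1 / (real x - 1)) \<le> 1"
    using x1 by (intro mult_le_one) auto
  then have "\<epsilon> \<le> 1 / 3 * 1"
    unfolding \<epsilon> using K x1 by (intro mult_mono) auto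
  moreover have "?a * \<epsilon> \<le> 1 / 3"
  proof -
    have "?a * \<epsilon> \<le> (real x - 1) ^ lam * \<epsilon>"
      using Fminus_le x1 by (intro mult_right_mono) (auto simp: \<epsilon>)
    also have "\<dots> = 1 / (real m * real (2 * lam + 1)) * ((real x - 1) / real x) ^ l"
      using x1 by (simp add: \<epsilon> l power_divide)
    also have "\<dots> \<le> 1 / 3 * 1"
      using K x1 by (intro mult_mono power_le_one) auto
    finally show ?thesis by simp
  qed
  ultimately have "Fminus = \<lfloor>?a * exp (s - (\<Sum>j<lam. ?t j)) + 1 / 2\<rfloor>"
    using Fminus_pos by (intro round_approximation[of _ _ _ \<epsilon>]) auto
  also have "?a * exp (s - (\<Sum>j<lam. ?t j)) = ?a * exp s * exp (- (\<Sum>j<lam. ?t j))"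
    by (simp add: exp_diff exp_minus field_simps)
  finally show ?thesis unfolding sqrt sum .
qed

end

theorem theorem3:
  fixes m n x lam :: nat and C D :: "int poly" and Fhat :: real and Fminus Fplus :: int
  assumes "m > 0" and "n > 1" and "squarefree n"
    and "is_aurif_pair n C D"
    and "x = m\<^sup>2 * n"
    and "lam = totient (2 * n) div 2"
    and "Fminus = poly C (int x) - int (m * n) * poly D (int x)"
    and "Fplus = poly C (int x) + int (m * n) * poly D (int x)"
    and "Fhat = sqrt (real_of_int (poly (aurif_F n) (int x))) *
           exp (- (1 / real m) *
             (\<Sum>j<lam. real_of_int (jacobi (int n) (2 * j + 1)) / (real (2 * j + 1) * real x ^ j)))"
  shows "Fminus = \<lfloor>Fhat + 1 / 2\<rfloor> \<and>
         real_of_int Fplus = real_of_int (poly (aurif_F n) (int x)) / real_of_int Fminus"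
proof -
  interpret A: aurifeuillian_factor n C D m x
    using assms(1-5) by unfold_locales
  have eqs: "lam = A.lam" "Fminus = A.Fminus" "Fplus = A.Fplus"
    using assms(6-8) by (simp_all add: A.lam_def A.Fminus_def A.Fplus_def)
  show ?thesis
  proof
    show "Fminus = \<lfloor>Fhat + 1 / 2\<rfloor>"
      unfolding assms(9) eqs by (rule A.Fminus_eq_floor)
    show "real_of_int Fplus = real_of_int (poly (aurif_F n) (int x)) / real_of_int Fminus"
      unfolding eqs A.Fminus_mult_Fplus[symmetric] using A.Fminus_pos by simp
  qed
qed

end
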